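(* Let $m\ge1$, let $G:\mathbb{R}\to\mathfrak{L}_n$ be Lipschitz continuous with respect to $d_\mu$, let $h>0$, $\delta\in[0,h)$, and suppose $F_i^0=G(\delta+ih)\in\mathfrak{J}_n$ for all $i\in\mathbb{Z}$. Let $F_k$ be the level-$k$ piecewise interpolants of the degree-$m$ set-valued spline scheme applied to $\{F_i^0\}$, reparametrized to the sample grid, i.e. $\widetilde F_k(x)=F_k((x-\delta)/h)$. Then there is a constant $C$ depending only on $m$ and on the Lipschitz constant of $G$ such that $d_\mu(G(x),\widetilde F_k(x))\le Ch$ for all $x\in\mathbb{R}$ and all $k\ge0$.
   Context: Notation: $\mu$ is $n$-dimensional Lebesgue measure; $\operatorname{ci}(E)$ is the closure of the interior of $E$; $\mathfrak{J}_n$ is the family of bounded sets $A\subset\mathbb{R}^n$ with $A=\operatorname{ci}(A)$ and $\mu(\partial A)=0$ (the empty set included); $d_\mu(A,B)=\mu(A\triangle B)$. $\mathfrak{L}_n$ is the complete metric space of Lebesgue measurable subsets of $\mathbb{R}^n$ of finite measure, with metric $d_\mu$ and sets differing by a null set identified; $\mathfrak{J}_n\subset\mathfrak{L}_n$. For nonempty bounded $A$: $d_S(p,A)=d(p,\partial A)$ if $p\in A$, $-d(p,\partial A)$ if $p\notin A$, where $d(q,E)=\min_{e\in E}\|q-e\|$. $O(B,r)=\{p:d(p,B)\le r\}$ for $r\ge0$. Distance average: for nonempty $A,B\in\mathfrak{J}_n$, $x\in\mathbb{R}$, $xA\,\widetilde\oplus\,(1-x)B=\{p: x d_S(p,A)+(1-x)d_S(p,B)\ge0\}$;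 if $A\ne\emptyset=B$, fix $q\in A$ maximizing $d_S(\cdot,A)$ over $A$ and set $xA\,\widetilde\oplus\,(1-x)B=\{p: x d_S(p,A)+(x-1)\|p-q\|\ge0\}$; the distance average of two empty sets is $\emptyset$. Let $h_{A,B}(x)=\mu(xA\,\widetilde\oplus\,(1-x)B)$. $A,B$ satisfy the zero-measure condition if $\mu(\{p: \tfrac12 d_S(p,A)+\tfrac12 d_S(p,B)=0\})=0$. Measure average $tA\oplus(1-t)B$ ($t\in\mathbb{R}$), defined in three steps (a fixed large number $N>0$ and, where needed, a fixed $\varepsilon>0$ are chosen once). Always $tA\oplus(1-t)A=A$. Step 1 (simply different: $B\subsetneq A$, $A\setminus B$ connected). If $A,B$ satisfy the zero-measure condition, or if $t\notin[0,1]$: $tA\oplus(1-t)B=\operatorname{ci}\big(gA\,\widetilde\oplus\,(1-g)B\big)$ where $g\in[-N,N]$ is any point attaining $\inf_{\xi\in[-N,N]}|h_{A,B}(\xi)-(t\mu(A)+(1-t)\mu(B))|$ (the set obtained does not depend on this choice). If the zero-measure condition fails and $t\in[0,1]$: $tA\oplus(1-t)B=\operatorname{ci}(O(B,r)\cap A)$ for any $r\ge0$ with $\mu(O(B,r)\cap A)=t\mu(A)+(1-t)\mu(B)$. Step 2 (nested: $B\subsetneq A$). If $A\setminus B$ has finitely many connected components, for each component $C$ let $R_{C,t}=t(B\cup C)\oplus(1-t)B$ (Step 1), and set $tA\oplus(1-t)B=\bigcup_C R_{C,t}$ for $t\ge0$ and $\operatorname{ci}\big(\bigcap_C R_{C,t}\big)$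 for $t<0$. If there are infinitely many components, all components of measure $<\varepsilon$ are merged into one set $U$, which is treated as a single component in these formulas. Step 3 (general $A,B$). Let $I=\operatorname{ci}(A\cap B)$, $R_{1,t}=tA\oplus(1-t)I$ and $R_{2,t}=(1-t)B\oplus tI$ (Step 2 averages of nested pairs, weight first on the larger set). Then $tA\oplus(1-t)B=R_{1,t}\cup R_{2,t}$ for $t\in[0,1]$; $=\operatorname{ci}(R_{1,t}\setminus(A\cap B))\cup R_{2,t}$ for $t>1$; and for $t<0$ it is defined as $(1-t)B\oplus tA$, computed by the $t>1$ rule with the roles of $A$ and $B$ exchanged (parameter $1-t>1$). Set-valued spline scheme of degree $m\ge1$: given $\{F_i^k\}_{i\in\mathbb{Z}}\subset\mathfrak{J}_n$, set $F_{2i}^{k+1,0}=F_i^k$, $F_{2i+1}^{k+1,0}=\tfrac12F_i^k\oplus\tfrac12F_{i+1}^k$; for $j=1,\dots,m-1$, $F_i^{k+1,j}=\tfrac12F_i^{k+1,j-1}\oplus\tfrac12F_{i+1}^{k+1,j-1}$; and $F_i^{k+1}=F^{k+1,m-1}_{i-\lfloor(m-1)/2\rfloor}$ ($i\in\mathbb{Z}$, $k=0,1,\dots$). The level-$k$ piecewise interpolant is $F_k(x)=\lambda(x)F_i^k\oplus(1-\lambda(x))F_{i+1}^k$ for $i2^{-k}\le x\le(i+1)2^{-k}$, with $\lambda(x)=(i+1)-x2^k$. *)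

theory Defs
  imports "HOL-Analysis.Analysis"
begin

definition ci :: "'a::topological_space set \<Rightarrow> 'a set" where
  "ci E = closure (interior E)"

definition Jn :: "'a::euclidean_space set \<Rightarrow> bool" where
  "Jn A \<longleftrightarrow> bounded A \<and> A = ci A \<and> frontier A \<in> null_sets lebesgue"

text \<open>Representatives of elements of L_n (measurable, finite measure).\<close>
definition Ln :: "'a::euclidean_space set \<Rightarrow> bool" where
  "Ln A \<longleftrightarrow> A \<in> sets lebesgue \<and> emeasure lebesgue A < \<infinity>"

definition dmu :: "'a::euclidean_space set \<Rightarrow> 'a set \<Rightarrow> real" where
  "dmu A B = measure lebesgue ((A - B) \<union> (B - A))"

definition dS :: "'a::euclidean_space \<Rightarrow> 'a set \<Rightarrow> real" where
  "dS p A = (if p \<in> A then infdist p (frontier A) else - infdist p (frontier A))"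

definition Obr :: "'a::euclidean_space set \<Rightarrow> real \<Rightarrow> 'a set" where
  "Obr B r = {p. infdist p B \<le> r}"

definition center :: "'a::euclidean_space set \<Rightarrow> 'a" where
  "center A = (SOME q. q \<in> A \<and> (\<forall>a\<in>A. dS a A \<le> dS q A))"

definition davg :: "real \<Rightarrow> 'a::euclidean_space set \<Rightarrow> 'a set \<Rightarrow> 'a set" where
  "davg x A B =
    (if A = {} \<and> B = {} then {}
     else if B = {} then {p. x * dS p A + (x - 1) * norm (p - center A) \<ge> 0}
     else if A = {} then {p. (1 - x) * dS p B + (- x) * norm (p - center B) \<ge> 0}
     else {p. x * dS p A + (1 - x) * dS p B \<ge> 0})"

definition hAB :: "'a::euclidean_space set \<Rightarrow> 'a set \<Rightarrow> real \<Rightarrow> real" where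
  "hAB A B x = measure lebesgue (davg x A B)"

definition zero_measure_cond :: "'a::euclidean_space set \<Rightarrow> 'a set \<Rightarrow> bool" where
  "zero_measure_cond A B \<longleftrightarrow> {p. dS p A / 2 + dS p B / 2 = 0} \<in> null_sets lebesgue"

definition avg1 :: "real \<Rightarrow> real \<Rightarrow> 'a::euclidean_space set \<Rightarrow> 'a set \<Rightarrow> 'a set" where
  "avg1 N t A B =
    (if A = B then A else
     (let c = t * measure lebesgue A + (1 - t) * measure lebesgue B in
      if zero_measure_cond A B \<or> t \<notin> {0..1} then
        ci (davg (SOME g. g \<in> {-N..N} \<and>
                 \<bar>hAB A B g - c\<bar> = (INF \<xi>\<in>{-N..N}. \<bar>hAB A B \<xi> - c\<bar>)) A B)
      else ci (Obr B (SOME r. r \<ge> 0 \<and> measure lebesgue (Obr B r \<inter> A) = c) \<inter> A)))"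

definition comps :: "real \<Rightarrow> 'a::euclidean_space set \<Rightarrow> 'a set \<Rightarrow> 'a set set" where
  "comps eps A B =
    (let K = components (A - B) in
     if finite K then K
     else {C \<in> K. measure lebesgue C \<ge> eps} \<union> {\<Union>{C \<in> K. measure lebesgue C < eps}})"

definition avg2 :: "real \<Rightarrow> real \<Rightarrow> real \<Rightarrow> 'a::euclidean_space set \<Rightarrow> 'a set \<Rightarrow> 'a set" where
  "avg2 N eps t A B =
    (if A = B then A
     else if t \<ge> 0 then (\<Union>C\<in>comps eps A B. avg1 N t (B \<union> C) B)
     else ci (\<Inter>C\<in>comps eps A B. avg1 N t (B \<union> C) B))"

text \<open>Step 3: general sets. mavg N eps t A B is t A (+) (1-t) B.\<close>
definition mavg :: "real \<Rightarrow> real \<Rightarrow> real \<Rightarrow> 'a::euclidean_space set \<Rightarrow> 'a set \<Rightarrow> 'a set" where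
  "mavg N eps t A B =
    (if A = B then A else
     (let I = ci (A \<inter> B) in
      if 0 \<le> t \<and> t \<le> 1 then avg2 N eps t A I \<union> avg2 N eps (1 - t) B I
      else if t > 1 then ci (avg2 N eps t A I - (A \<inter> B)) \<union> avg2 N eps (1 - t) B I
      else ci (avg2 N eps (1 - t) B I - (A \<inter> B)) \<union> avg2 N eps t A I))"

definition refine :: "real \<Rightarrow> real \<Rightarrow> nat \<Rightarrow> (int \<Rightarrow> 'a::euclidean_space set) \<Rightarrow> (int \<Rightarrow> 'a set)" where
  "refine N eps m F =
    (let F0 = (\<lambda>i. if even i then F (i div 2)
                   else mavg N eps (1/2) (F (i div 2)) (F (i div 2 + 1)));
         Fm = ((\<lambda>H i. mavg N eps (1/2) (H i) (H (i + 1))) ^^ (m - 1)) F0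
     in (\<lambda>i. Fm (i - int ((m - 1) div 2))))"

definition spline :: "real \<Rightarrow> real \<Rightarrow> nat \<Rightarrow> (int \<Rightarrow> 'a::euclidean_space set) \<Rightarrow> nat \<Rightarrow> (int \<Rightarrow> 'a set)" where
  "spline N eps m F k = (refine N eps m ^^ k) F"

definition interp :: "real \<Rightarrow> real \<Rightarrow> (int \<Rightarrow> 'a::euclidean_space set) \<Rightarrow> nat \<Rightarrow> real \<Rightarrow> 'a set" where
  "interp N eps Fk k x =
    (let i = \<lfloor>x * 2 ^ k\<rfloor> in
     mavg N eps (of_int (i + 1) - x * 2 ^ k) (Fk i) (Fk (i + 1)))"

end

theory Submission
  imports Defs
begin

text \<open>The whole estimate rests on the metric property of the measure average: for \<open>t \<in> [0,1]\<close> the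
  average \<open>M\<close> of \<open>A\<close> and \<open>B\<close> satisfies \<open>d(M,A) = (1 - t) d(A,B)\<close> and \<open>d(M,B) = t d(A,B)\<close>. Then one
  refinement step halves the maximal distance of neighbouring sets, since inserting midpoints halves
  it and the averaging steps do not increase it, while every set moves by at most \<open>m\<close> times that
  distance; summing the geometric series gives a bound \<open>(2m + 4) L h\<close>.

  For the metric property one needs, for nested sets, a set of exactly the prescribed measure that
  lies between them almost everywhere. It is found by the intermediate value theorem, because the
  measure of \<open>{p. x d\<^sub>S(p,A) + (1 - x) d\<^sub>S(p,B) \<ge> 0}\<close> depends continuously on \<open>x\<close> once the
  corresponding level sets are null. For \<open>x \<noteq> 1/2\<close> they are null unconditionally: moving towards the
  nearest boundary point with the larger weight changes the level at a definite rate, so the level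
  set is porous. Since the family is monotone in \<open>x\<close>, every other parameter that yields the same
  measure, inside or outside \<open>[0,1]\<close>, yields the same set up to a null set.\<close>

section \<open>Negligible sets\<close>

lemma AE_not_in_negligible: "negligible S \<Longrightarrow> AE p in lebesgue. p \<notin> S"
  using AE_not_in by (simp add: negligible_iff_null_sets)

text \<open>Squeeze \<open>Z\<close> into an open \<open>U\<close> with \<open>U - Z\<close> of
  measure below \<open>e\<close>. Vitali covers \<open>Z\<close> up to a null set by disjoint balls
  in \<open>U\<close>; each contains a hole missing \<open>Z\<close> with volume fraction
  \<open>\<eta> ^ DIM('a)\<close>. The holes are disjoint and lie in \<open>U - Z\<close>, so that
  fraction of the measure of \<open>Z\<close> is below \<open>e\<close>.\<close>

lemma negligible_if_porous:
  fixes Z :: "'a::euclidean_space set"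
  assumes Z: "Z \<in> lmeasurable" and \<eta>: "0 < \<eta>"
    and por: "\<And>x e. x \<in> Z \<Longrightarrow> 0 < e \<Longrightarrow>
      \<exists>r y. 0 < r \<and> r < e \<and> ball y (\<eta> * r) \<subseteq> ball x r \<and> ball y (\<eta> * r) \<inter> Z = {}"
  shows "negligible Z"
proof -
  have main: "\<eta> ^ DIM('a) * measure lebesgue Z \<le> e" if e: "e > 0" for e
  proof -
    obtain U where U: "open U" "Z \<subseteq> U" "emeasure lebesgue (U - Z) < ennreal e"
      using sets_lebesgue_outer_open[OF fmeasurableD[OF Z] e] by metis
    \<comment> \<open>Each index carries its hole centre along with the ball, so the Vitali
      subfamily brings its holes with it.\<close>
    define K where "K = {(x, r, y). x \<in> Z \<and> 0 < r \<and> ball x r \<subseteq> U \<and> ball y (\<eta> * r) \<subseteq> ball x r \<and> ball y (\<eta> * r) \<inter> Z = {}}"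
    define a :: "'a \<times> real \<times> 'a \<Rightarrow> 'a" where "a = fst"
    define r :: "'a \<times> real \<times> 'a \<Rightarrow> real" where "r = (\<lambda>i. fst (snd i))"
    define y :: "'a \<times> real \<times> 'a \<Rightarrow> 'a" where "y = (\<lambda>i. snd (snd i))"
    have "\<exists>i. i \<in> K \<and> x \<in> ball (a i) (r i) \<and> r i < d" if x: "x \<in> Z" and d: "0 < d" for x d
    proof -
      obtain d' where d': "d' > 0" "ball x d' \<subseteq> U"
        using U x by (meson openE subsetD)
      obtain s w where s: "0 < s" "s < min d d'" "ball w (\<eta> * s) \<subseteq> ball x s" "ball w (\<eta> * s) \<inter> Z = {}"
        using por[OF x, of "min d d'"] d d' by auto
      have "ball x s \<subseteq> U" using d' s(2) by auto
      then have "(x, s, w) \<in> K" using s x by (auto simp: K_def)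
      then show ?thesis using s by (intro exI[of _ "(x, s, w)"]) (auto simp: a_def r_def)
    qed
    then obtain C where C: "countable C" "C \<subseteq> K"
      and disj: "pairwise (\<lambda>i j. disjnt (ball (a i) (r i)) (ball (a j) (r j))) C"
      and neg: "negligible (Z - (\<Union>i\<in>C. ball (a i) (r i)))"
      by (rule Vitali_covering_theorem_balls[of Z K a r])
    have K: "r i > 0" "ball (a i) (r i) \<subseteq> U" "ball (y i) (\<eta> * r i) \<subseteq> ball (a i) (r i)" "ball (y i) (\<eta> * r i) \<inter> Z = {}"
      if "i \<in> C" for i
    proof -
      have "i \<in> K" using that C by blast
      then show "r i > 0" "ball (a i) (r i) \<subseteq> U" "ball (y i) (\<eta> * r i) \<subseteq> ball (a i) (r i)" "ball (y i) (\<eta> * r i) \<inter> Z = {}"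
        by (simp_all add: K_def a_def r_def y_def case_prod_beta)
    qed
    have dfam: "disjoint_family_on (\<lambda>i. ball (a i) (r i)) C"
      using disj by (auto simp: disjoint_family_on_def pairwise_def disjnt_def)
    have dfam2: "disjoint_family_on (\<lambda>i. ball (y i) (\<eta> * r i)) C"
      unfolding disjoint_family_on_def
    proof (intro ballI impI)
      fix i j assume "i \<in> C" "j \<in> C" "i \<noteq> j"
      then show "ball (y i) (\<eta> * r i) \<inter> ball (y j) (\<eta> * r j) = {}"
        using K(3)[of i] K(3)[of j] dfam by (force simp: disjoint_family_on_def)
    qed
    have sc: "emeasure lebesgue (ball (y i) (\<eta> * r i)) = ennreal (\<eta> ^ DIM('a)) * emeasure lebesgue (ball (a i) (r i))"
      if "i \<in> C" for i
      using K(1)[OF that] \<eta>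
      by (simp add: emeasure_ball ennreal_mult[symmetric] power_mult_distrib mult_ac)
    have "emeasure lebesgue Z \<le> emeasure lebesgue (\<Union>i\<in>C. ball (a i) (r i))"
    proof (rule emeasure_mono_AE)
      show "AE x in lebesgue. x \<in> Z \<longrightarrow> x \<in> (\<Union>i\<in>C. ball (a i) (r i))"
        using AE_not_in_negligible[OF neg] by eventually_elim auto
    qed (use C in \<open>auto intro!: borel_open open_UN\<close>)
    then have "ennreal (\<eta> ^ DIM('a)) * emeasure lebesgue Z
        \<le> ennreal (\<eta> ^ DIM('a)) * emeasure lebesgue (\<Union>i\<in>C. ball (a i) (r i))"
      by (rule mult_left_mono) auto
    also have "\<dots> = (\<integral>\<^sup>+i. ennreal (\<eta> ^ DIM('a)) * emeasure lebesgue (ball (a i) (r i)) \<partial>count_space C)"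
      using C dfam by (subst emeasure_UN_countable) (auto simp: nn_integral_cmult)
    also have "\<dots> = (\<integral>\<^sup>+i. emeasure lebesgue (ball (y i) (\<eta> * r i)) \<partial>count_space C)"
      by (intro nn_integral_cong) (metis sc space_count_space)
    also have "\<dots> = emeasure lebesgue (\<Union>i\<in>C. ball (y i) (\<eta> * r i))"
      using C dfam2 by (subst emeasure_UN_countable) auto
    also have "\<dots> \<le> emeasure lebesgue (U - Z)"
      using K U Z by (intro emeasure_mono) (blast, auto)
    also have "\<dots> < ennreal e" by fact
    finally have "ennreal (\<eta> ^ DIM('a)) * emeasure lebesgue Z < ennreal e" .
    then have "ennreal (\<eta> ^ DIM('a) * measure lebesgue Z) < ennreal e"
      using Z \<eta> by (simp add: emeasure_eq_measure2 ennreal_mult)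
    then show ?thesis using e by (simp add: ennreal_less_iff \<eta> less_imp_le)
  qed
  have "\<eta> ^ DIM('a) * measure lebesgue Z \<le> 0"
    using main by (meson field_le_epsilon add_0 dense_ge)
  then have "measure lebesgue Z = 0"
    using \<eta> by (smt (verit) measure_nonneg mult_pos_pos zero_less_power)
  then show ?thesis using Z by (simp add: negligible_iff_measure)
qed

text \<open>If a Lipschitz function moves away from zero at a definite rate in some direction at every
  point of a level set, the level set is porous.\<close>

lemma negligible_level_set:
  fixes Z :: "'a::euclidean_space set" and \<phi> :: "'a \<Rightarrow> real"
  assumes Z: "Z \<in> lmeasurable" and lip: "\<And>p q. \<bar>\<phi> p - \<phi> q\<bar> \<le> dist p q"
    and 0: "\<And>p. p \<in> Z \<Longrightarrow> \<phi> p = 0" and \<kappa>: "\<kappa> > 0"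
    and mv: "\<And>p. p \<in> Z \<Longrightarrow> \<exists>s0>0. \<forall>s. 0 < s \<and> s < s0 \<longrightarrow> (\<exists>p'. dist p p' \<le> s \<and> \<kappa> * s \<le> \<bar>\<phi> p'\<bar>)"
  shows "negligible Z"
proof (rule negligible_if_porous[OF Z])
  show "0 < \<kappa> / (1 + \<kappa>)" using \<kappa> by simp
  fix x and e :: real assume x: "x \<in> Z" and e: "0 < e"
  obtain s0 where s0: "s0 > 0" "\<And>s. 0 < s \<Longrightarrow> s < s0 \<Longrightarrow> \<exists>p'. dist x p' \<le> s \<and> \<kappa> * s \<le> \<bar>\<phi> p'\<bar>"
    using mv[OF x] by blast
  have "0 < e / (1 + \<kappa>)" using e \<kappa> by simp
  then obtain s where s: "0 < s" "s < s0" "s < e / (1 + \<kappa>)"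
    using field_lbound_gt_zero[OF s0(1)] by blast
  obtain p' where p': "dist x p' \<le> s" "\<kappa> * s \<le> \<bar>\<phi> p'\<bar>" using s0(2)[OF s(1,2)] by blast
  \<comment> \<open>The function has size at least \<open>\<kappa> * s\<close> at \<open>p'\<close>
    and is 1-Lipschitz, so the ball of radius \<open>\<kappa> * s\<close> there contains no zero. It
    fits into the ball of radius \<open>s + \<kappa> * s\<close> about \<open>x\<close>, which fixes
    the ratio \<open>\<kappa> / (1 + \<kappa>)\<close>.\<close>
  have eq: "\<kappa> / (1 + \<kappa>) * (s * (1 + \<kappa>)) = \<kappa> * s" using \<kappa> by simp
  show "\<exists>r y. 0 < r \<and> r < e \<and> ball y (\<kappa> / (1 + \<kappa>) * r) \<subseteq> ball x r \<and> ball y (\<kappa> / (1 + \<kappa>) * r) \<inter> Z = {}"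
  proof (intro exI[of _ "s * (1 + \<kappa>)"] exI[of _ p'] conjI)
    show "0 < s * (1 + \<kappa>)" "s * (1 + \<kappa>) < e" using s \<kappa> by (auto simp: field_simps add_pos_pos)
    show "ball p' (\<kappa> / (1 + \<kappa>) * (s * (1 + \<kappa>))) \<subseteq> ball x (s * (1 + \<kappa>))"
      unfolding eq
    proof
      fix z assume "z \<in> ball p' (\<kappa> * s)"
      then have "dist x z < s + \<kappa> * s" using p'(1) dist_triangle[of x z p'] by auto
      then show "z \<in> ball x (s * (1 + \<kappa>))" by (simp add: algebra_simps)
    qed
    show "ball p' (\<kappa> / (1 + \<kappa>) * (s * (1 + \<kappa>))) \<inter> Z = {}"
      unfolding eq
    proof (intro equals0I)
      fix z assume "z \<in> ball p' (\<kappa> * s) \<inter> Z"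
      then show False using lip[of p' z] 0[of z] p'(2) by auto
    qed
  qed
qed

section \<open>Level sets of distance functions\<close>

lemma infdist_move_towards:
  fixes p :: "'a::euclidean_space"
  assumes E: "closed E" "E \<noteq> {}" and s: "0 \<le> s" "s \<le> infdist p E"
  obtains p' where "dist p p' = s" "infdist p' E \<le> infdist p E - s"
proof (cases "infdist p E = 0")
  case True
  then show ?thesis using s by (intro that[of p]) auto
next
  case False
  obtain e where e: "e \<in> E" "infdist p E = dist p e"
    using infdist_attains_inf[OF E] by blast
  define d where "d = dist p e"
  have d: "d > 0" using False e by (simp add: d_def)
  define p' where "p' = p + (s / d) *\<^sub>R (e - p)"
  have d_eq: "norm (e - p) = d" by (simp add: d_def dist_norm norm_minus_commute)
  have "dist p p' = s" using d s by (simp add: p'_def dist_norm d_eq)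
  moreover have "e - p' = (1 - s / d) *\<^sub>R (e - p)" by (simp add: p'_def algebra_simps)
  then have "dist p' e = \<bar>1 - s / d\<bar> * d" using d_eq by (simp add: dist_norm norm_minus_commute)
  then have "dist p' e = d - s" using d s e by (simp add: d_def abs_if left_diff_distrib)
  then have "infdist p' E \<le> infdist p E - s" using infdist_le[OF e(1), of p'] e(2) by (simp add: d_def)
  ultimately show ?thesis by (rule that)
qed

lemma bounded_borel_lmeasurable: "S \<in> sets borel \<Longrightarrow> bounded S \<Longrightarrow> S \<in> lmeasurable"
  for S :: "'a::euclidean_space set"
  by (rule bounded_set_imp_lmeasurable) auto

text \<open>Moving by \<open>s < r\<close> towards a nearest point of \<open>E\<close> lowers the
  distance by at least \<open>s\<close>, so the level set is left at rate 1.\<close>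

lemma negligible_infdist_level:
  fixes E :: "'a::euclidean_space set"
  assumes E: "closed E" "bounded E" "E \<noteq> {}" and r: "r > 0"
  shows "negligible {p. infdist p E = r}"
proof (rule negligible_level_set[where \<phi> = "\<lambda>p. infdist p E - r" and \<kappa> = 1])
  have "closed {p. infdist p E = r}"
    by (intro closed_Collect_eq continuous_intros)
  moreover have "{p. infdist p E = r} \<subseteq> {p. infdist p E \<le> r}" by auto
  then have "bounded {p. infdist p E = r}"
    using compact_infdist_le[of E r] E r compact_eq_bounded_closed bounded_subset by (metis (no_types, lifting))
  ultimately show "{p. infdist p E = r} \<in> lmeasurable"
    by (intro bounded_borel_lmeasurable borel_closed)
  fix p assume "p \<in> {p. infdist p E = r}"
  then have p: "infdist p E = r" by simp
  show "\<exists>s0>0. \<forall>s. 0 < s \<and> s < s0 \<longrightarrow> (\<exists>p'. dist p p' \<le> s \<and> 1 * s \<le> \<bar>infdist p' E - r\<bar>)"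
  proof (intro exI[of _ r] conjI allI impI r)
    fix s assume s: "0 < s \<and> s < r"
    then obtain p' where "dist p p' = s" "infdist p' E \<le> infdist p E - s"
      using infdist_move_towards[OF E(1,3), of s p] p by auto
    then show "\<exists>p'. dist p p' \<le> s \<and> 1 * s \<le> \<bar>infdist p' E - r\<bar>"
      using p s by (intro exI[of _ p']) auto
  qed
qed (auto intro: order_trans[OF _ infdist_triangle_abs])

text \<open>A move by \<open>s\<close> towards \<open>E1\<close> lowers the first term by at least
  \<open>x * s\<close>, while the second falls by at most \<open>(1 - x) * s\<close>. The net rate
  \<open>2 * x - 1\<close> is positive because \<open>E1\<close> has the larger weight.\<close>

lemma negligible_infdist_ratio_aux:
  fixes E1 E2 S :: "'a::euclidean_space set"
  assumes E: "closed E1" "E1 \<noteq> {}" and S: "bounded S" "S \<in> sets borel" and x: "1/2 < x" "x < 1"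
  shows "negligible {p \<in> S. x * infdist p E1 = (1 - x) * infdist p E2 \<and> infdist p E1 > 0}" (is "negligible ?Z")
proof (rule negligible_level_set[where \<phi> = "\<lambda>p. x * infdist p E1 - (1 - x) * infdist p E2" and \<kappa> = "2 * x - 1"])
  have "{p. x * infdist p E1 = (1 - x) * infdist p E2 \<and> infdist p E1 > 0} =
    {p. x * infdist p E1 = (1 - x) * infdist p E2} \<inter> {p. infdist p E1 > 0}" by auto
  moreover have "\<dots> \<in> sets borel"
    by (intro sets.Int borel_closed borel_open closed_Collect_eq open_Collect_less continuous_intros)
  ultimately have "?Z \<in> sets borel" using S(2) by (simp add: Collect_conj_eq)
  moreover have "bounded ?Z" by (rule bounded_subset[OF S(1)]) auto
  ultimately show "?Z \<in> lmeasurable" by (rule bounded_borel_lmeasurable)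
  show "2 * x - 1 > 0" using x by simp
  show "\<bar>x * infdist p E1 - (1 - x) * infdist p E2 - (x * infdist q E1 - (1 - x) * infdist q E2)\<bar> \<le> dist p q" for p q
  proof -
    have "\<bar>x * infdist p E1 - (1 - x) * infdist p E2 - (x * infdist q E1 - (1 - x) * infdist q E2)\<bar>
      = \<bar>x * (infdist p E1 - infdist q E1) - (1 - x) * (infdist p E2 - infdist q E2)\<bar>"
      by (simp add: algebra_simps)
    also have "\<dots> \<le> \<bar>x * (infdist p E1 - infdist q E1)\<bar> + \<bar>(1 - x) * (infdist p E2 - infdist q E2)\<bar>"
      by (rule abs_triangle_ineq4)
    also have "\<dots> \<le> x * dist p q + (1 - x) * dist p q"
      using x by (intro add_mono) (auto simp: abs_mult intro!: mult_left_mono infdist_triangle_abs)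
    finally show ?thesis by (simp add: algebra_simps)
  qed
  fix p assume "p \<in> ?Z"
  then have p: "x * infdist p E1 = (1 - x) * infdist p E2" "infdist p E1 > 0" by auto
  show "\<exists>s0>0. \<forall>s. 0 < s \<and> s < s0 \<longrightarrow>
      (\<exists>p'. dist p p' \<le> s \<and> (2 * x - 1) * s \<le> \<bar>x * infdist p' E1 - (1 - x) * infdist p' E2\<bar>)"
  proof (intro exI[of _ "infdist p E1"] conjI allI impI p(2))
    fix s assume s: "0 < s \<and> s < infdist p E1"
    then obtain p' where p': "dist p p' = s" "infdist p' E1 \<le> infdist p E1 - s"
      using infdist_move_towards[OF E, of s p] by auto
    have "x * infdist p' E1 \<le> x * (infdist p E1 - s)" using p' x by (intro mult_left_mono) auto
    moreover have "(1 - x) * (infdist p E2 - s) \<le> (1 - x) * infdist p' E2"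
      using infdist_triangle[of p E2 p'] p' x by (intro mult_left_mono) auto
    ultimately have "x * infdist p' E1 - (1 - x) * infdist p' E2 \<le> - ((2 * x - 1) * s)"
      using p(1) by (simp add: algebra_simps)
    then show "\<exists>p'. dist p p' \<le> s \<and> (2 * x - 1) * s \<le> \<bar>x * infdist p' E1 - (1 - x) * infdist p' E2\<bar>"
      using p' by (intro exI[of _ p']) auto
  qed
qed auto

lemma negligible_infdist_ratio:
  fixes E1 E2 S :: "'a::euclidean_space set"
  assumes E: "closed E1" "E1 \<noteq> {}" "closed E2" "E2 \<noteq> {}" and S: "bounded S" "S \<in> sets borel"
    and x: "0 < x" "x < 1" "x \<noteq> 1/2"
  shows "negligible {p \<in> S. x * infdist p E1 = (1 - x) * infdist p E2 \<and> infdist p E1 > 0 \<and> infdist p E2 > 0}"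
proof (cases "x > 1/2")
  case True
  show ?thesis
    by (rule negligible_subset[OF negligible_infdist_ratio_aux[OF E(1,2) S True x(2), of E2]]) auto
next
  case False
  \<comment> \<open>Now \<open>E2\<close> has the larger weight, so the two sets exchange
    roles.\<close>
  then have y: "1/2 < 1 - x" "1 - x < 1" using x by auto
  show ?thesis
    by (rule negligible_subset[OF negligible_infdist_ratio_aux[OF E(3,4) S y, of E1]]) auto
qed

text \<open>A ray from \<open>q\<close> meets the equidistant set at most once: if \<open>p\<close> and then \<open>p'\<close> were two such
  points, the nearest point of \<open>E\<close> to \<open>p\<close> would have to be \<open>q\<close>.\<close>

lemma negligible_equidistant_point:
  fixes q :: "'a::euclidean_space"
  assumes E: "closed E" "E \<noteq> {}" and q: "q \<notin> E"
  shows "negligible {p. infdist p E = norm (p - q)}"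
proof (rule starlike_negligible[where a = q])
  show "closed {p. infdist p E = norm (p - q)}"
    by (intro closed_Collect_eq continuous_intros)
  have no: False if v: "infdist (q + v) E = norm v" and w: "infdist (q + c *\<^sub>R v) E = norm (c *\<^sub>R v)" and c: "c > 1" for v c
  proof -
    have v0: "v \<noteq> 0" using v q E in_closed_iff_infdist_zero by fastforce
    obtain e where e: "e \<in> E" "infdist (q + v) E = dist (q + v) e"
      using infdist_attains_inf[OF E] by blast
    have ne: "norm (e - (q + v)) = norm v" using e v by (simp add: dist_norm norm_minus_commute)
    have n1: "norm ((q + v) - (q + c *\<^sub>R v)) = (c - 1) * norm v"
    proof -
      have "(q + v) - (q + c *\<^sub>R v) = (1 - c) *\<^sub>R v" by (simp add: algebra_simps)
      then show ?thesis using c by simp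
    qed
    \<comment> \<open>The point \<open>e\<close> is at least \<open>norm (c *\<^sub>R v)\<close>
      away from the farther point, and the path through \<open>q + v\<close> has exactly this
      length. Equality in the triangle inequality makes the two legs parallel, and their lengths
      then force \<open>e = q\<close>.\<close>
    have "norm ((e - (q + v)) + ((q + v) - (q + c *\<^sub>R v))) \<ge> norm (c *\<^sub>R v)"
      using infdist_le[OF e(1), of "q + c *\<^sub>R v"] unfolding w
      by (simp add: dist_norm norm_minus_commute[of _ e] diff_diff_eq del: norm_scaleR)
    then have "norm ((e - (q + v)) + ((q + v) - (q + c *\<^sub>R v))) = norm (e - (q + v)) + norm ((q + v) - (q + c *\<^sub>R v))"
      using norm_triangle_ineq[of "e - (q + v)" "(q + v) - (q + c *\<^sub>R v)"] c unfolding ne n1 by (simp add: algebra_simps)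
    then have "norm v *\<^sub>R ((q + v) - (q + c *\<^sub>R v)) = ((c - 1) * norm v) *\<^sub>R (e - (q + v))"
      using norm_triangle_eq[of "e - (q + v)" "(q + v) - (q + c *\<^sub>R v)"] unfolding ne n1 by simp
    then have "norm v *\<^sub>R ((c - 1) *\<^sub>R (e - q)) = 0" by (simp add: algebra_simps)
    then have "e = q" using v0 c by simp
    then show False using q e by simp
  qed
  fix c x assume A: "q + c *\<^sub>R x \<in> {p. infdist p E = norm (p - q)}" "0 \<le> c" "q + x \<in> {p. infdist p E = norm (p - q)}"
  have c0: "c \<noteq> 0"
  proof
    assume "c = 0"
    then have "infdist q E = 0" using A(1) by simp
    then show False using q E in_closed_iff_infdist_zero by blast
  qed
  show "c = 1"
  proof (rule ccontr)
    assume "c \<noteq> 1"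
    then consider "c > 1" | "c < 1" "c > 0" using A(2) c0 by linarith
    then show False
    proof cases
      case 1 then show ?thesis using no[of x c] A by simp
    next
      case 2
      \<comment> \<open>The point \<open>q + c *\<^sub>R x\<close> is now the nearer one, and the
        factor \<open>1 / c\<close> leads from it to the other.\<close>
      then show ?thesis using no[of "c *\<^sub>R x" "1 / c"] A by simp
    qed
  qed
qed

text \<open>Exempting points at which \<open>f y p\<close> is never negative makes the lemma cover \<open>f r p = r - d(p,B)\<close>
  at \<open>r = 0\<close>, where the level set is \<open>B\<close> itself.\<close>

lemma continuous_on_measure_superlevel:
  fixes f :: "real \<Rightarrow> 'a::euclidean_space \<Rightarrow> real" and A :: "'a set"
  assumes A: "A \<in> lmeasurable" and cx: "\<And>p. continuous_on T (\<lambda>x. f x p)"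
    and cp: "\<And>x. x \<in> T \<Longrightarrow> continuous_on UNIV (f x)"
    and neg: "\<And>x. x \<in> T \<Longrightarrow> negligible {p \<in> A. f x p = 0 \<and> (\<exists>y\<in>T. f y p < 0)}"
  shows "continuous_on T (\<lambda>x. measure lebesgue ({p. 0 \<le> f x p} \<inter> A))"
proof (rule continuous_on_sequentiallyI)
  fix X a assume X: "\<forall>n. X n \<in> T" "a \<in> T" "X \<longlonglongrightarrow> a"
  have Am: "A \<in> sets lebesgue" using A by auto
  have S: "{p. 0 \<le> f x p} \<inter> A \<in> sets lebesgue" if "x \<in> T" for x
    using Am closed_Collect_le[OF continuous_on_const cp[OF that]]
    by (intro sets.Int) auto
  have eq: "(\<integral>p. indicat_real ({p. 0 \<le> f x p} \<inter> A) p \<partial>lebesgue) = measure lebesgue ({p. 0 \<le> f x p} \<inter> A)" if "x \<in> T" for x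
    using S[OF that] by simp
  have "(\<lambda>n. \<integral>p. indicat_real ({p. 0 \<le> f (X n) p} \<inter> A) p \<partial>lebesgue)
      \<longlonglongrightarrow> (\<integral>p. indicat_real ({p. 0 \<le> f a p} \<inter> A) p \<partial>lebesgue)"
  proof (rule integral_dominated_convergence[where w = "indicat_real A"])
    show "integrable lebesgue (indicat_real A)"
      using A by (simp add: lmeasurable_iff_integrable)
    have "AE p in lebesgue. p \<notin> {p \<in> A. f a p = 0 \<and> (\<exists>y\<in>T. f y p < 0)}"
      by (rule AE_not_in_negligible[OF neg[OF X(2)]])
    then show "AE p in lebesgue. (\<lambda>n. indicat_real ({p. 0 \<le> f (X n) p} \<inter> A) p)
        \<longlonglongrightarrow> indicat_real ({p. 0 \<le> f a p} \<inter> A) p"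
    proof eventually_elim
      case (elim p)
      have lim: "(\<lambda>n. f (X n) p) \<longlonglongrightarrow> f a p"
        using cx[of p] X unfolding continuous_on_sequentially comp_def by blast
      have "\<forall>\<^sub>F n in sequentially. indicat_real ({p. 0 \<le> f (X n) p} \<inter> A) p = indicat_real ({p. 0 \<le> f a p} \<inter> A) p"
      proof (cases "p \<in> A")
        case True
        \<comment> \<open>A nonzero sign persists along the sequence; in the third case the
          indicator is 1 at every parameter in \<open>T\<close>.\<close>
        then consider "f a p > 0" | "f a p < 0" | "f a p = 0" "\<And>y. y \<in> T \<Longrightarrow> f y p \<ge> 0"
          using elim True by (cases "f a p" "0 :: real" rule: linorder_cases) (force simp: not_less)+
        then show ?thesis
        proof cases
          case 1
          show ?thesis using order_tendstoD(1)[OF lim 1] by eventually_elim (use 1 in \<open>auto simp: indicator_def\<close>)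
        next
          case 2
          show ?thesis using order_tendstoD(2)[OF lim 2] by eventually_elim (use 2 in \<open>auto simp: indicator_def\<close>)
        next
          case 3
          then show ?thesis using X by (auto simp: indicator_def)
        qed
      qed auto
      then show ?case by (rule tendsto_eventually)
    qed
  qed (use S X in \<open>auto intro!: borel_measurable_indicator split: split_indicator\<close>)
  then show "(\<lambda>n. measure lebesgue ({p. 0 \<le> f (X n) p} \<inter> A)) \<longlonglongrightarrow> measure lebesgue ({p. 0 \<le> f a p} \<inter> A)"
    using eq X by simp
qed

section \<open>Jordan measurable sets\<close>

text \<open>The part of \<open>Jn\<close> that survives before \<open>ci\<close> is applied:
  superlevel sets and unions of \<open>B\<close> with components are handled at this level.\<close>

definition jordan :: "'a::euclidean_space set \<Rightarrow> bool" where
  "jordan S \<longleftrightarrow> bounded S \<and> negligible (frontier S)"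

lemma jordan_lmeasurable: "jordan S \<Longrightarrow> S \<in> lmeasurable"
  by (simp add: jordan_def measurable_Jordan)

lemma jordan_Un: "jordan S \<Longrightarrow> jordan T \<Longrightarrow> jordan (S \<union> T)"
  unfolding jordan_def by (auto intro: negligible_subset[OF _ frontier_Un_subset] negligible_Un)

lemma jordan_Int: "jordan S \<Longrightarrow> jordan T \<Longrightarrow> jordan (S \<inter> T)"
  unfolding jordan_def by (auto intro: negligible_subset[OF _ frontier_Int_subset] negligible_Un)

text \<open>Both \<open>S\<close> and \<open>ci S\<close> lie between the interior and the closure
  of \<open>S\<close>.\<close>

lemma negligible_ci_symdiff:
  assumes "negligible (frontier S)"
  shows "negligible (S - ci S)" "negligible (ci S - S)"
proof -
  have "S - ci S \<subseteq> frontier S" "ci S - S \<subseteq> frontier S"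
    using closure_subset[of "interior S"] closure_subset[of S] closure_mono[OF interior_subset, of S] interior_subset[of S]
    by (auto simp: ci_def frontier_def)
  then show "negligible (S - ci S)" "negligible (ci S - S)"
    using assms negligible_subset by blast+
qed

lemma ci_ci: "ci (ci S) = ci S"
proof
  show "ci (ci S) \<subseteq> ci S"
    unfolding ci_def by (metis closure_closed closed_closure closure_mono interior_subset)
  show "ci S \<subseteq> ci (ci S)"
    unfolding ci_def by (intro closure_mono interior_maximal closure_subset open_interior)
qed

lemma frontier_ci_subset: "frontier (ci S) \<subseteq> frontier S"
proof -
  have "closure (interior S) \<subseteq> closure S" by (intro closure_mono interior_subset)
  moreover have "interior S \<subseteq> interior (closure (interior S))"
    by (intro interior_maximal closure_subset open_interior)
  ultimately show ?thesis by (auto simp: ci_def frontier_def)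
qed

lemma ci_subset: "closed S \<Longrightarrow> ci S \<subseteq> S"
  unfolding ci_def by (metis closure_minimal interior_subset)

lemma Jn_iff: "Jn S \<longleftrightarrow> jordan S \<and> ci S = S"
  by (auto simp: Jn_def jordan_def negligible_iff_null_sets)

lemma Jn_closed: "Jn S \<Longrightarrow> closed S"
  by (metis Jn_def ci_def closed_closure)

lemma Jn_ci:
  assumes "jordan S" shows "Jn (ci S)"
  unfolding Jn_iff jordan_def
proof (intro conjI ci_ci)
  show "bounded (ci S)"
    using assms unfolding ci_def jordan_def by (meson bounded_closure bounded_interior)
  show "negligible (frontier (ci S))"
    using assms negligible_subset[OF _ frontier_ci_subset] by (auto simp: jordan_def)
qed

text \<open>Closure commutes with the finite union of the interiors; this keeps the unions formed in
  Steps 2 and 3 regular closed.\<close>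

lemma Jn_Un:
  assumes "Jn S" "Jn T" shows "Jn (S \<union> T)"
proof -
  have "S \<union> T = ci S \<union> ci T" using assms by (simp add: Jn_iff)
  also have "\<dots> = closure (interior S \<union> interior T)" by (simp add: ci_def)
  also have "\<dots> \<subseteq> ci (S \<union> T)"
    unfolding ci_def by (intro closure_mono) (meson Un_least Un_upper1 Un_upper2 interior_mono)
  finally have "S \<union> T \<subseteq> ci (S \<union> T)" .
  moreover have "ci (S \<union> T) \<subseteq> S \<union> T"
    using assms by (intro ci_subset closed_Un Jn_closed)
  ultimately show ?thesis using assms by (auto simp: Jn_iff jordan_Un)
qed

lemma Jn_empty: "Jn {}"
  by (simp add: Jn_def ci_def)

lemma Jn_UN: "finite I \<Longrightarrow> (\<And>i. i \<in> I \<Longrightarrow> Jn (X i)) \<Longrightarrow> Jn (\<Union>i\<in>I. X i)"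
  by (induction I rule: finite_induct) (auto simp: Jn_empty Jn_Un)

text \<open>The point is that a closed set agreeing almost everywhere with \<open>T\<close> contains the interior of \<open>T\<close>.\<close>

lemma negligible_frontier_if_ae_eq:
  fixes S T :: "'a::euclidean_space set"
  assumes S: "closed S" and T: "negligible (frontier T)" and "negligible (S - T)" "negligible (T - S)"
  shows "negligible (frontier S)"
proof -
  have "interior T - S = {}"
  proof (rule ccontr)
    assume "interior T - S \<noteq> {}"
    moreover have "open (interior T - S)" using S by (simp add: open_Diff)
    moreover have "negligible (interior T - S)"
      by (rule negligible_subset[OF assms(4)]) (use interior_subset in blast)
    ultimately show False using open_not_negligible by blast
  qed
  then have "interior T \<subseteq> interior S" by (metis Diff_eq_empty_iff interior_maximal open_interior)
  then have "frontier S \<subseteq> (S - T) \<union> frontier T"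
    using closure_closed[OF S] closure_subset[of T] by (auto simp: frontier_def)
  then show ?thesis using assms negligible_Un negligible_subset by blast
qed

lemma measure_ae_eq:
  assumes "S \<in> lmeasurable" "negligible (S - T)" "negligible (T - S)"
  shows "measure lebesgue T = measure lebesgue S"
  using assms by (intro measure_negligible_symdiff) (auto intro: negligible_Un)

lemma measure_ae_Diff:
  assumes "S \<in> lmeasurable" "T \<in> lmeasurable" "negligible (T - S)"
  shows "measure lebesgue (S - T) = measure lebesgue S - measure lebesgue T"
proof -
  have "measure lebesgue (S - T) = measure lebesgue (S - (S \<inter> T))"
    by (simp add: Diff_Int)
  also have "\<dots> = measure lebesgue S - measure lebesgue (S \<inter> T)"
    using assms by (intro measurable_measure_Diff) auto
  also have "measure lebesgue (S \<inter> T) = measure lebesgue T"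
    using assms(2) by (rule measure_negligible_symdiff) (use assms(3) in \<open>auto elim!: negligible_subset\<close>)
  finally show ?thesis .
qed

section \<open>Signed distance\<close>

text \<open>The segment from \<open>p\<close> to \<open>e\<close> meets the frontier, at
  \<open>e\<close> itself if \<open>e \<in> S\<close>, and points of the segment are no farther from
  \<open>p\<close> than \<open>e\<close> is.\<close>

lemma infdist_frontier_le:
  fixes p :: "'a::euclidean_space"
  assumes "p \<in> S" "e \<in> closure (- S)"
  shows "infdist p (frontier S) \<le> dist p e"
proof -
  have "\<exists>z \<in> closed_segment p e. z \<in> frontier S"
  proof (cases "e \<in> S")
    case True
    then show ?thesis using assms closure_subset by (fastforce simp: frontier_closures)
  next
    case False
    then have "closed_segment p e \<inter> frontier S \<noteq> {}"
      using assms by (intro connected_Int_frontier connected_segment) auto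
    then show ?thesis by auto
  qed
  then obtain z where z: "z \<in> closed_segment p e" "z \<in> frontier S" by blast
  have "infdist p (frontier S) \<le> dist p z" by (rule infdist_le[OF z(2)])
  also have "\<dots> \<le> dist p e" using dist_in_closed_segment[OF z(1)] by (simp add: dist_commute)
  finally show ?thesis .
qed

lemma infdist_frontier_le':
  fixes p :: "'a::euclidean_space"
  assumes "p \<notin> S" "e \<in> closure S"
  shows "infdist p (frontier S) \<le> dist p e"
  using infdist_frontier_le[of p "- S" e] assms by (simp add: frontier_complement)

lemma frontier_bounded_nonempty:
  fixes S :: "'a::euclidean_space set"
  shows "bounded S \<Longrightarrow> S \<noteq> {} \<Longrightarrow> frontier S \<noteq> {}"
  by (metis frontier_not_empty not_bounded_UNIV)

text \<open>The two branches can only clash on the common part of \<open>closure A\<close> and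
  \<open>closure (- A)\<close>, which is the frontier, where the distance is 0.\<close>

lemma continuous_on_dS: "continuous_on UNIV (\<lambda>p. dS p (A :: 'a::euclidean_space set))"
proof (cases "frontier A = {}")
  case True
  \<comment> \<open>By convention \<open>infdist\<close> to the empty set is 0.\<close>
  have "dS p A = 0" for p unfolding dS_def True by (simp add: infdist_def)
  then show ?thesis by (rule continuous_on_eq[OF continuous_on_const, OF sym])
next
  case False
  have z: "infdist p (frontier A) = 0" if "p \<in> closure A" "p \<in> closure (- A)" for p
    using that by (simp add: frontier_closures)
  have "continuous_on (closure A \<union> closure (- A)) (\<lambda>p. if p \<in> A then infdist p (frontier A) else - infdist p (frontier A))"
  proof (rule continuous_on_cases)
    show "\<forall>x. x \<in> closure A \<and> x \<notin> A \<or> x \<in> closure (- A) \<and> x \<in> A \<longrightarrow>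
        infdist x (frontier A) = - infdist x (frontier A)"
      using z closure_subset[of A] closure_subset[of "- A"] by auto
  qed (auto intro!: continuous_intros)
  moreover have "closure A \<union> closure (- A) = UNIV"
    using closure_subset[of A] closure_subset[of "- A"] by auto
  ultimately show ?thesis by (simp add: dS_def)
qed

lemma dS_eq_0_iff:
  assumes "frontier A \<noteq> {}"
  shows "dS p A = 0 \<longleftrightarrow> p \<in> frontier A"
  using in_closed_iff_infdist_zero[OF frontier_closed assms, of p] by (auto simp: dS_def)

lemma dS_nonneg_iff:
  assumes "frontier A \<noteq> {}"
  shows "0 \<le> dS p A \<longleftrightarrow> p \<in> closure A"
proof -
  have "0 \<le> dS p A \<longleftrightarrow> p \<in> A \<or> dS p A = 0"
    using infdist_nonneg[of p "frontier A"] by (auto simp: dS_def)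
  also have "\<dots> \<longleftrightarrow> p \<in> closure A"
    unfolding dS_eq_0_iff[OF assms] by (auto simp: closure_Un_frontier)
  finally show ?thesis .
qed

lemma abs_dS: "\<bar>dS p A\<bar> = infdist p (frontier A)"
  by (simp add: dS_def infdist_nonneg)

text \<open>Inside \<open>B\<close>, the frontier of \<open>A\<close> lies in the closure of the
  complement of \<open>B\<close>, so it cannot be nearer than the frontier of \<open>B\<close>;
  outside \<open>A\<close> the argument is dual. In between, the signs decide.\<close>

lemma dS_mono:
  fixes A B :: "'a::euclidean_space set"
  assumes "B \<subseteq> A" "frontier A \<noteq> {}" "frontier B \<noteq> {}"
  shows "dS p B \<le> dS p A"
proof -
  consider "p \<in> B" | "p \<notin> B" "p \<in> A" | "p \<notin> A" by blast
  then show ?thesis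
  proof cases
    case 1
    have "infdist p (frontier B) \<le> dist p e" if "e \<in> frontier A" for e
      using that assms(1) closure_mono[of "- A" "- B"] by (intro infdist_frontier_le 1) (auto simp: frontier_closures)
    then have "infdist p (frontier B) \<le> infdist p (frontier A)"
      using assms(2) by (simp add: infdist_notempty cINF_greatest)
    then show ?thesis using 1 assms(1) by (auto simp: dS_def)
  next
    case 2
    then show ?thesis using infdist_nonneg[of p "frontier A"] infdist_nonneg[of p "frontier B"] by (auto simp: dS_def)
  next
    case 3
    have "infdist p (frontier A) \<le> dist p e" if "e \<in> frontier B" for e
      using that assms(1) closure_mono[of B A] by (intro infdist_frontier_le' 3) (auto simp: frontier_closures)
    then have "infdist p (frontier A) \<le> infdist p (frontier B)"
      using assms(3) by (simp add: infdist_notempty cINF_greatest)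
    then show ?thesis using 3 assms(1) by (auto simp: dS_def)
  qed
qed

text \<open>Lets \<open>- dist p q\<close> act as the signed distance to an inner set shrunk to the
  point \<open>q\<close>, which is how an empty inner set is treated.\<close>

lemma dS_ge_minus_dist:
  fixes A :: "'a::euclidean_space set"
  assumes "q \<in> closure A"
  shows "- dist p q \<le> dS p A"
proof (cases "p \<in> A")
  case True
  then show ?thesis using infdist_nonneg[of p "frontier A"] zero_le_dist[of p q] by (simp add: dS_def del: zero_le_dist)
next
  case False
  then show ?thesis using infdist_frontier_le'[OF False assms] by (simp add: dS_def)
qed

lemma dS_le_outside:
  fixes A :: "'a::euclidean_space set"
  assumes A: "A \<subseteq> cball b R" "frontier A \<noteq> {}" and p: "p \<notin> A"
  shows "dS p A \<le> R - dist p b"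
proof -
  have "dist p b - R \<le> dist p e" if "e \<in> frontier A" for e
  proof -
    have "closure A \<subseteq> cball b R" using A(1) closure_minimal by blast
    then have "dist b e \<le> R" using that by (auto simp: frontier_def)
    then show ?thesis using dist_triangle[of p b e] by (simp add: dist_commute)
  qed
  then have "dist p b - R \<le> infdist p (frontier A)"
    using assms(2) by (simp add: infdist_notempty cINF_greatest)
  then show ?thesis using p by (simp add: dS_def)
qed

lemma center_maximizes:
  fixes A :: "'a::euclidean_space set"
  assumes "bounded A" "A \<noteq> {}"
  shows "center A \<in> A" "\<And>a. a \<in> A \<Longrightarrow> dS a A \<le> dS (center A) A"
proof -
  have "\<exists>q. q \<in> A \<and> (\<forall>a\<in>A. dS a A \<le> dS q A)"
  proof -
    have "compact (closure A)" "closure A \<noteq> {}" using assms by (auto simp: compact_eq_bounded_closed)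
    then obtain q where q: "q \<in> closure A" "\<And>a. a \<in> closure A \<Longrightarrow> dS a A \<le> dS q A"
      using continuous_attains_sup[of "closure A" "\<lambda>p. dS p A"] continuous_on_subset[OF continuous_on_dS] by blast
    show ?thesis
    proof (cases "q \<in> A")
      case True
      then show ?thesis using q closure_subset by blast
    next
      case False
      \<comment> \<open>A maximum attained outside \<open>A\<close> is at most 0, so the signed
        distance vanishes on all of \<open>A\<close> and any of its points will do.\<close>
      then have "dS q A \<le> 0" using infdist_nonneg[of q "frontier A"] by (simp add: dS_def)
      then have le: "dS a A \<le> 0" if "a \<in> A" for a
        using q(2)[of a] that closure_subset[of A] by (meson in_mono order_trans)
      obtain a where a: "a \<in> A" using assms by blast
      then have "0 \<le> dS a A" by (simp add: dS_def infdist_nonneg)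
      then show ?thesis using a le by (meson order_trans)
    qed
  qed
  then have "center A \<in> A \<and> (\<forall>a\<in>A. dS a A \<le> dS (center A) A)"
    unfolding center_def by (rule someI_ex)
  then show "center A \<in> A" "\<And>a. a \<in> A \<Longrightarrow> dS a A \<le> dS (center A) A" by auto
qed

section \<open>Sets of prescribed measure in a monotone family\<close>

lemma convex_comb_mono:
  fixes a b :: real
  assumes "b \<le> a" "x \<le> y"
  shows "x * a + (1 - x) * b \<le> y * a + (1 - y) * b"
proof -
  have "0 \<le> (y - x) * (a - b)" using assms by simp
  then show ?thesis by (simp add: algebra_simps)
qed

text \<open>Serves both forms of \<open>davg\<close> at once: \<open>a\<close> is the signed
  distance to the outer set, \<open>b\<close> that to the inner set or, if this is empty, minus the
  distance to the centre. Linking \<open>h\<close>, \<open>X\<close> and \<open>g\<close> by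
  equations lets \<open>hAB\<close>, \<open>davg\<close> and the choice in \<open>avg1\<close> be
  substituted for them.\<close>

lemma superlevel_family_attains:
  fixes a b :: "'a::euclidean_space \<Rightarrow> real"
  assumes a: "continuous_on UNIV a" and b: "continuous_on UNIV b" and ba: "\<And>p. b p \<le> a p"
    and bd: "\<And>x. bounded {p. 0 \<le> x * a p + (1 - x) * b p}"
    and neg: "\<And>x. x \<in> {0..1} \<Longrightarrow> negligible {p. x * a p + (1 - x) * b p = 0}"
    and N: "1 \<le> N" and c: "measure lebesgue {p. 0 \<le> b p} \<le> c" "c \<le> measure lebesgue {p. 0 \<le> a p}"
    and h: "\<And>x. h x = measure lebesgue (X x)" and X: "\<And>x. X x = {p. 0 \<le> x * a p + (1 - x) * b p}"
    and g: "g = (SOME g. g \<in> {-N..N} \<and> \<bar>h g - c\<bar> = (INF \<xi>\<in>{-N..N}. \<bar>h \<xi> - c\<bar>))"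
  shows "closed (X g)" "jordan (X g)" "measure lebesgue (X g) = c"
    "negligible ({p. 0 \<le> b p} - X g)" "negligible (X g - {p. 0 \<le> a p})"
proof -
  have cont: "continuous_on UNIV (\<lambda>p. x * a p + (1 - x) * b p)" for x
    by (intro continuous_intros a b)
  have clX: "closed (X x)" for x
    unfolding X by (intro closed_Collect_le continuous_on_const cont)
  have bdX: "bounded (X x)" for x using bd X by simp
  have mX: "X x \<in> lmeasurable" for x
    using clX bdX by (intro bounded_borel_lmeasurable) auto
  have mono: "X x \<subseteq> X y" if "x \<le> y" for x y
    using convex_comb_mono[OF ba that] unfolding X by (auto intro: order_trans)
  have X0: "X 0 = {p. 0 \<le> b p}" and X1: "X 1 = {p. 0 \<le> a p}" by (simp_all add: X)
  \<comment> \<open>Intersecting with \<open>X 1\<close> supplies the dominating set of finite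
    measure; it changes nothing for \<open>x \<le> 1\<close> by monotonicity.\<close>
  have "continuous_on {0..1} (\<lambda>x. measure lebesgue ({p. 0 \<le> x * a p + (1 - x) * b p} \<inter> X 1))"
  proof (rule continuous_on_measure_superlevel[OF mX])
    fix x :: real assume "x \<in> {0..1}"
    then show "negligible {p \<in> X 1. x * a p + (1 - x) * b p = 0 \<and> (\<exists>y\<in>{0..1}. y * a p + (1 - y) * b p < 0)}"
      by (intro negligible_subset[OF neg]) auto
  qed (auto intro!: continuous_intros a b)
  then have "continuous_on {0..1} h"
  proof (rule continuous_on_eq)
    fix x :: real assume "x \<in> {0..1}"
    then have "X x \<inter> X 1 = X x" using mono by auto
    then show "measure lebesgue ({p. 0 \<le> x * a p + (1 - x) * b p} \<inter> X 1) = h x"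
      by (simp add: h X)
  qed
  then obtain g0 where g0: "0 \<le> g0" "g0 \<le> 1" "h g0 = c"
    using IVT'[of h 0 c 1] c by (auto simp: h X0 X1)
  \<comment> \<open>The parameter \<open>g0\<close> lies in the search interval because
    \<open>1 \<le> N\<close>, and its error is 0. So the infimum is 0 and every minimiser attains
    the measure \<open>c\<close> exactly.\<close>
  have "(INF \<xi>\<in>{-N..N}. \<bar>h \<xi> - c\<bar>) = 0"
  proof (rule antisym)
    have "(INF \<xi>\<in>{-N..N}. \<bar>h \<xi> - c\<bar>) \<le> \<bar>h g0 - c\<bar>"
      using g0 N by (intro cINF_lower bdd_belowI2[where m = 0]) auto
    then show "(INF \<xi>\<in>{-N..N}. \<bar>h \<xi> - c\<bar>) \<le> 0" using g0 by simp
    show "0 \<le> (INF \<xi>\<in>{-N..N}. \<bar>h \<xi> - c\<bar>)"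
      using N by (intro cINF_greatest) auto
  qed
  moreover from this have "\<exists>g. g \<in> {-N..N} \<and> \<bar>h g - c\<bar> = (INF \<xi>\<in>{-N..N}. \<bar>h \<xi> - c\<bar>)"
    using g0 N by (intro exI[of _ g0]) auto
  from someI_ex[OF this] have "\<bar>h g - c\<bar> = (INF \<xi>\<in>{-N..N}. \<bar>h \<xi> - c\<bar>)" unfolding g by blast
  ultimately have hg: "h g = c" by simp
  have null: "negligible (X x - X y)" if "h x = h y" for x y
  proof (cases "x \<le> y")
    case True
    then show ?thesis using mono[OF True] by (metis Diff_eq_empty_iff negligible_empty)
  next
    case False
    then have "X y \<subseteq> X x" using mono by auto
    then have "measure lebesgue (X x - X y) = 0"
      using measurable_measure_Diff[of "X x" lebesgue "X y"] mX that by (auto simp: h)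
    then show ?thesis unfolding negligible_iff_measure using fmeasurable.Diff[OF mX mX] by blast
  qed
  have n1: "negligible (X g - X g0)" and n2: "negligible (X g0 - X g)"
    using null hg g0 by auto
  have "frontier (X g0) \<subseteq> {p. g0 * a p + (1 - g0) * b p = 0}"
  proof -
    have "{p. 0 < g0 * a p + (1 - g0) * b p} \<subseteq> interior (X g0)"
      unfolding X by (intro interior_maximal open_Collect_less continuous_on_const cont) auto
    then show ?thesis using closure_closed[OF clX[of g0]] by (force simp: frontier_def X)
  qed
  then have "negligible (frontier (X g0))" using neg g0 negligible_subset by auto
  \<comment> \<open>The chosen \<open>g\<close> may lie outside \<open>{0..1}\<close>, where
    \<open>neg\<close> says nothing; its frontier is controlled through the almost equal set
    \<open>X g0\<close>.\<close>
  then have "negligible (frontier (X g))"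
    using negligible_frontier_if_ae_eq clX n1 n2 by blast
  then show "jordan (X g)" using bdX by (simp add: jordan_def)
  show "closed (X g)" by (rule clX)
  show "measure lebesgue (X g) = c" using hg h by simp
  have "{p. 0 \<le> b p} - X g \<subseteq> X g0 - X g" "X g - {p. 0 \<le> a p} \<subseteq> X g - X g0"
    unfolding X0[symmetric] X1[symmetric] using mono g0 by blast+
  then show "negligible ({p. 0 \<le> b p} - X g)" "negligible (X g - {p. 0 \<le> a p})"
    by (auto intro: negligible_subset[OF n1] negligible_subset[OF n2])
qed

section \<open>Averages of nested sets\<close>

text \<open>The inclusions hold only up to null sets, since the choice of the parameter and
  \<open>ci\<close> preserve no more than that.\<close>

definition partway :: "real \<Rightarrow> 'a::euclidean_space set \<Rightarrow> 'a set \<Rightarrow> 'a set \<Rightarrow> bool" where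
  "partway t A B M \<longleftrightarrow> Jn M \<and> negligible (B - M) \<and> negligible (M - A) \<and>
     measure lebesgue M = t * measure lebesgue A + (1 - t) * measure lebesgue B"

lemma partway_ci:
  assumes X: "jordan X" and "negligible (B - X)" "negligible (X - A)"
    and "measure lebesgue X = t * measure lebesgue A + (1 - t) * measure lebesgue B"
  shows "partway t A B (ci X)"
proof -
  have fr: "negligible (frontier X)" using X by (simp add: jordan_def)
  note n = negligible_ci_symdiff[OF fr]
  have "measure lebesgue (ci X) = measure lebesgue X"
    using jordan_lmeasurable[OF X] n by (rule measure_ae_eq)
  moreover have "negligible (B - ci X)"
    by (rule negligible_subset[OF negligible_Un[OF assms(2) n(1)]]) auto
  moreover have "negligible (ci X - A)"
    by (rule negligible_subset[OF negligible_Un[OF assms(3) n(2)]]) auto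
  ultimately show ?thesis using Jn_ci[OF X] assms(4) by (simp add: partway_def)
qed

lemma negligible_closure_minus_jordan: "jordan A \<Longrightarrow> negligible (closure A - A)"
  by (rule negligible_subset[of "frontier A"]) (auto simp: jordan_def closure_Un_frontier)

lemma measure_closure_jordan:
  assumes "jordan A" shows "measure lebesgue (closure A) = measure lebesgue A"
  using jordan_lmeasurable[OF assms] _ negligible_closure_minus_jordan[OF assms]
  by (rule measure_ae_eq) (simp add: Diff_eq_empty_iff[THEN iffD2, OF closure_subset])

text \<open>Superlevel sets of the signed distance see only \<open>closure A\<close>, while the
  outer sets \<open>B \<union> C\<close> of Step 2 need not be closed.\<close>

lemma partway_closure:
  assumes "jordan A" "partway t (closure A) B M"
  shows "partway t A B M"
proof -
  have "negligible (M - A)"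
    by (rule negligible_subset[OF negligible_Un[of "M - closure A" "closure A - A"]])
      (use assms negligible_closure_minus_jordan in \<open>auto simp: partway_def\<close>)
  then show ?thesis using assms(2) unfolding partway_def measure_closure_jordan[OF assms(1)] by blast
qed

text \<open>Outside \<open>A\<close>, with \<open>d = dist p b\<close>, the combination is at most
  \<open>dS p A \<le> R - d\<close> if \<open>x \<le> 1\<close>. If \<open>x > 1\<close> it is at
  most \<open>x * (R - d) + (x - 1) * d = x * R - d\<close>. These give the two radii in the
  maximum.\<close>

lemma bounded_dS_comb:
  fixes A :: "'a::euclidean_space set"
  assumes A: "A \<subseteq> cball b R" "frontier A \<noteq> {}"
    and \<beta>: "\<And>p. \<beta> p \<le> dS p A" "\<And>p. - dist p b \<le> \<beta> p"
  shows "bounded {p. 0 \<le> x * dS p A + (1 - x) * \<beta> p}"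
proof (rule bounded_subset[OF bounded_cball])
  show "{p. 0 \<le> x * dS p A + (1 - x) * \<beta> p} \<subseteq> cball b (max R (x * R))"
  proof
    fix p assume "p \<in> {p. 0 \<le> x * dS p A + (1 - x) * \<beta> p}"
    then have p: "0 \<le> x * dS p A + (1 - x) * \<beta> p" by simp
    show "p \<in> cball b (max R (x * R))"
    proof (cases "p \<in> A")
      case True
      then show ?thesis using A(1) by auto
    next
      case False
      note le = dS_le_outside[OF A False]
      show ?thesis
      proof (cases "x \<le> 1")
        case True
        have "x * dS p A + (1 - x) * \<beta> p \<le> dS p A"
          using convex_comb_mono[OF \<beta>(1)[of p] True] by simp
        then show ?thesis using p le by (simp add: dist_commute)
      next
        case False
        have "x * dS p A \<le> x * (R - dist p b)" using False le by (intro mult_left_mono) auto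
        moreover have "(x - 1) * - dist p b \<le> (x - 1) * \<beta> p" using False \<beta>(2) by (intro mult_left_mono) auto
        ultimately show ?thesis using p by (simp add: algebra_simps dist_commute)
      qed
    qed
  qed
qed

text \<open>At the endpoints the level set is a frontier, and at \<open>1/2\<close> it is null by
  the zero-measure condition. Elsewhere it lies, off the frontiers, in a set where the two distances
  have a fixed ratio other than 1.\<close>

lemma negligible_dS_level:
  fixes A B :: "'a::euclidean_space set"
  assumes A: "jordan A" and B: "jordan B" "B \<subseteq> A" "B \<noteq> {}"
    and x: "x \<in> {0..1}" and z: "zero_measure_cond A B"
  shows "negligible {p. x * dS p A + (1 - x) * dS p B = 0}"
proof -
  have ne: "frontier A \<noteq> {}" "frontier B \<noteq> {}"
    using A B frontier_bounded_nonempty by (auto simp: jordan_def)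
  have fr: "negligible (frontier A)" "negligible (frontier B)" using A B by (auto simp: jordan_def)
  consider "x = 0" | "x = 1" | "x = 1/2" | "0 < x" "x < 1" "x \<noteq> 1/2" using x by fastforce
  then show ?thesis
  proof cases
    case 1 then show ?thesis using fr by (simp add: dS_eq_0_iff ne)
  next
    case 2 then show ?thesis using fr by (simp add: dS_eq_0_iff ne)
  next
    case 3
    then have "{p. x * dS p A + (1 - x) * dS p B = 0} = {p. dS p A / 2 + dS p B / 2 = 0}"
      unfolding 3 by simp
    then show ?thesis using z by (simp add: zero_measure_cond_def negligible_iff_null_sets)
  next
    case 4
    let ?Z = "{p \<in> closure A. x * infdist p (frontier A) = (1 - x) * infdist p (frontier B) \<and>
      infdist p (frontier A) > 0 \<and> infdist p (frontier B) > 0}"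
    have neg: "negligible ?Z"
      using A ne 4 by (intro negligible_infdist_ratio) (auto simp: jordan_def)
    have "{p. x * dS p A + (1 - x) * dS p B = 0} \<subseteq> (frontier A \<union> frontier B) \<union> ?Z"
    proof
      fix p assume "p \<in> {p. x * dS p A + (1 - x) * dS p B = 0}"
      then have p: "x * dS p A = - ((1 - x) * dS p B)" by simp
      show "p \<in> (frontier A \<union> frontier B) \<union> ?Z"
      proof (cases "p \<in> frontier A \<union> frontier B")
        case False
        have "\<bar>x * dS p A\<bar> = \<bar>(1 - x) * dS p B\<bar>" using p by simp
        then have eq: "x * infdist p (frontier A) = (1 - x) * infdist p (frontier B)"
          using 4 by (simp add: abs_mult abs_dS)
        have pos: "infdist p (frontier A) > 0" "infdist p (frontier B) > 0"
          using False ne by (auto simp: abs_dS[symmetric] dS_eq_0_iff)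
        \<comment> \<open>Outside the closure both signed distances are negative, so a combination
          with positive weights cannot vanish.\<close>
        have "p \<in> closure A"
        proof (rule ccontr)
          assume "p \<notin> closure A"
          then have "dS p A < 0" "dS p B < 0"
            using dS_nonneg_iff[OF ne(1)] dS_mono[OF B(2) ne, of p] by (meson not_le order_le_less_trans)+
          then have "x * dS p A < 0" "(1 - x) * dS p B < 0" using 4 by (auto simp: mult_pos_neg)
          then show False using p by simp
        qed
        then show ?thesis using eq pos by simp
      qed auto
    qed
    then show ?thesis using neg fr negligible_Un negligible_subset by meson
  qed
qed

text \<open>The counterpart for an empty inner set. Here even \<open>x = 1/2\<close> is
  unconditional, by \<open>negligible_equidistant_point\<close>, provided the centre is off the
  frontier.\<close>

lemma negligible_dS_point_level:
  fixes A :: "'a::euclidean_space set"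
  assumes A: "jordan A" "A \<noteq> {}" and x: "x \<in> {0..1}"
  shows "negligible {p. x * dS p A + (1 - x) * - norm (p - center A) = 0}"
proof -
  define q where "q = center A"
  have q: "q \<in> A" "\<And>a. a \<in> A \<Longrightarrow> dS a A \<le> dS q A"
    using center_maximizes A by (auto simp: q_def jordan_def)
  have bd: "bounded A" and fr: "negligible (frontier A)" using A by (auto simp: jordan_def)
  have ne: "frontier A \<noteq> {}" using A frontier_bounded_nonempty by (auto simp: jordan_def)
  consider "x = 0" | "x = 1" | "0 < x" "x < 1" using x by fastforce
  then show ?thesis unfolding q_def[symmetric]
  proof cases
    case 1 then show "negligible {p. x * dS p A + (1 - x) * - norm (p - q) = 0}" by simp
  next
    case 2 then show "negligible {p. x * dS p A + (1 - x) * - norm (p - q) = 0}" using fr by (simp add: dS_eq_0_iff ne)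
  next
    case 3
    show "negligible {p. x * dS p A + (1 - x) * - norm (p - q) = 0}"
    proof (cases "q \<in> frontier A")
      case True
      \<comment> \<open>A centre on the frontier makes the maximal signed distance 0, so both terms
        are nonpositive and vanish together only at \<open>q\<close>.\<close>
      have le: "dS p A \<le> 0" for p
      proof (cases "p \<in> A")
        case True
        then show ?thesis using q(2)[OF True] \<open>q \<in> frontier A\<close> dS_eq_0_iff[OF ne, of q] by simp
      qed (simp add: dS_def infdist_nonneg)
      have "{p. x * dS p A + (1 - x) * - norm (p - q) = 0} \<subseteq> {q}"
      proof
        fix p assume p: "p \<in> {p. x * dS p A + (1 - x) * - norm (p - q) = 0}"
        have "x * dS p A \<le> 0" using 3 le by (simp add: mult_le_0_iff)
        then have "(1 - x) * norm (p - q) \<le> 0" using p by simp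
        then show "p \<in> {q}" using 3 by (simp add: mult_le_0_iff)
      qed
      then show ?thesis using negligible_subset negligible_sing by blast
    next
      case False
      let ?Z = "{p \<in> closure A. x * infdist p (frontier A) = (1 - x) * infdist p {q} \<and>
        infdist p (frontier A) > 0 \<and> infdist p {q} > 0}"
      have neg: "negligible ?Z"
      proof (cases "x = 1/2")
        case True
        show ?thesis
          by (rule negligible_subset[OF negligible_equidistant_point[OF frontier_closed ne False]])
            (auto simp: True dist_norm)
      next
        case False
        then show ?thesis
          using bd ne 3 by (intro negligible_infdist_ratio) auto
      qed
      have "{p. x * dS p A + (1 - x) * - norm (p - q) = 0} \<subseteq> (frontier A \<union> {q}) \<union> ?Z"
      proof
        fix p assume "p \<in> {p. x * dS p A + (1 - x) * - norm (p - q) = 0}"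
        then have p: "x * dS p A = (1 - x) * dist p q" by (simp add: dist_norm)
        have "0 \<le> x * dS p A" using 3 unfolding p by simp
        then have "0 \<le> dS p A" using 3 by (simp add: zero_le_mult_iff)
        then have "p \<in> closure A" "dS p A = infdist p (frontier A)"
          using dS_nonneg_iff[OF ne] by (auto simp: abs_dS[symmetric])
        then show "p \<in> (frontier A \<union> {q}) \<union> ?Z"
          using p dS_eq_0_iff[OF ne, of p] infdist_nonneg[of p "frontier A"] by (auto simp: less_le)
      qed
      then show ?thesis using neg fr negligible_Un negligible_sing negligible_subset by meson
    qed
  qed
qed

text \<open>By convention \<open>dS p {} = 0\<close>, so the condition concerns the frontier of
  \<open>A\<close> alone; an empty inner set therefore always falls into the \<open>davg\<close>
  branch.\<close>

lemma zero_measure_cond_empty: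
  assumes "jordan A" "A \<noteq> {}"
  shows "zero_measure_cond A {}"
proof -
  have "frontier A \<noteq> {}" using assms frontier_bounded_nonempty by (auto simp: jordan_def)
  then have "{p. dS p A / 2 + dS p {} / 2 = 0} = frontier A"
    using dS_eq_0_iff[of A] by (auto simp: dS_def[of _ "{}"] infdist_def)
  then show ?thesis using assms by (simp add: zero_measure_cond_def jordan_def negligible_iff_null_sets)
qed

section \<open>Step 1 averages\<close>

lemma partway_davg:
  fixes A B :: "'a::euclidean_space set"
  assumes A: "jordan A" "A \<noteq> {}" and B: "Jn B" "B \<subseteq> A" and t: "t \<in> {0..1}" and N: "1 \<le> N"
    and z: "zero_measure_cond A B"
    and c: "c = t * measure lebesgue A + (1 - t) * measure lebesgue B"
  shows "partway t A B (ci (davg (SOME g. g \<in> {-N..N} \<and>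
     \<bar>hAB A B g - c\<bar> = (INF \<xi>\<in>{-N..N}. \<bar>hAB A B \<xi> - c\<bar>)) A B))"
proof -
  have ne: "frontier A \<noteq> {}" and bd: "bounded A" and fr: "negligible (frontier A)"
    using A frontier_bounded_nonempty by (auto simp: jordan_def)
  have BJ: "jordan B" using B by (simp add: Jn_iff)
  \<comment> \<open>If \<open>B\<close> is empty, \<open>q\<close> is the centre appearing in
    \<open>davg\<close>; otherwise it is any point of \<open>B\<close>, used for the lower bound on
    \<open>\<beta>\<close>.\<close>
  define q where "q = (if B = {} then center A else (SOME b. b \<in> B))"
  have qA: "q \<in> A"
  proof (cases "B = {}")
    case True then show ?thesis using center_maximizes(1)[OF bd A(2)] by (simp add: q_def)
  next
    case False
    then have "q \<in> B" using some_in_eq[of B] by (simp add: q_def)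
    then show ?thesis using B by auto
  qed
  define \<beta> where "\<beta> = (\<lambda>p. if B = {} then - norm (p - q) else dS p B)"
  have neB: "frontier B \<noteq> {}" if "B \<noteq> {}"
    using that BJ frontier_bounded_nonempty by (auto simp: jordan_def)
  have \<beta>1: "\<beta> p \<le> dS p A" for p
    using dS_ge_minus_dist[of q A p] closure_subset[of A] qA dS_mono[OF B(2) ne neB, of p]
    by (auto simp: \<beta>_def dist_norm)
  have \<beta>2: "- dist p q \<le> \<beta> p" for p
  proof (cases "B = {}")
    case False
    then have "q \<in> B" using some_in_eq[of B] by (simp add: q_def)
    then show ?thesis using dS_ge_minus_dist[of q B p] closure_subset[of B] False by (auto simp: \<beta>_def)
  qed (auto simp: \<beta>_def dist_norm)
  have contB: "continuous_on UNIV \<beta>"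
    unfolding \<beta>_def by (cases "B = {}") (auto intro!: continuous_intros continuous_on_dS)
  obtain R where R: "A \<subseteq> cball q R"
    using bounded_subset_ballD[OF bd, of q] ball_subset_cball by (meson order_trans)
  have davg: "davg x A B = {p. 0 \<le> x * dS p A + (1 - x) * \<beta> p}" for x
    using A(2) by (auto simp: davg_def \<beta>_def q_def algebra_simps)
  have neg: "negligible {p. x * dS p A + (1 - x) * \<beta> p = 0}" if "x \<in> {0..1}" for x
    using negligible_dS_level[OF A(1) BJ B(2) _ that z] negligible_dS_point_level[OF A that]
    by (cases "B = {}") (simp_all add: \<beta>_def q_def)
  have clA: "{p. 0 \<le> dS p A} = closure A" by (simp add: dS_nonneg_iff ne)
  \<comment> \<open>For empty \<open>B\<close> the lower end of the family is the single point
    \<open>q\<close>, which is null, so its measure still agrees with that of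
    \<open>B\<close>.\<close>
  have "{p. 0 \<le> \<beta> p} = (if B = {} then {q} else B)"
    using closure_closed[OF Jn_closed[OF B(1)]] by (auto simp: \<beta>_def dS_nonneg_iff neB)
  then have clB: "measure lebesgue {p. 0 \<le> \<beta> p} = measure lebesgue B" "B \<subseteq> {p. 0 \<le> \<beta> p}"
    by auto
  have mA: "measure lebesgue (closure A) = measure lebesgue A"
    by (rule measure_closure_jordan[OF A(1)])
  have "measure lebesgue B \<le> measure lebesgue A"
    using A BJ B by (intro measure_mono_fmeasurable) (auto dest: jordan_lmeasurable)
  then have "0 \<le> t * (measure lebesgue A - measure lebesgue B)" "0 \<le> (1 - t) * (measure lebesgue A - measure lebesgue B)"
    using t by auto
  then have c': "measure lebesgue {p. 0 \<le> \<beta> p} \<le> c" "c \<le> measure lebesgue {p. 0 \<le> dS p A}"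
    unfolding c clA clB mA by (auto simp: algebra_simps)
  note * = superlevel_family_attains[OF continuous_on_dS contB \<beta>1 bounded_dS_comb[OF R ne \<beta>1 \<beta>2] neg N c' _ davg refl, of "hAB A B"]
  show ?thesis
  proof (rule partway_closure[OF A(1)], rule partway_ci)
    let ?g = "SOME g. g \<in> {-N..N} \<and> \<bar>hAB A B g - c\<bar> = (INF \<xi>\<in>{-N..N}. \<bar>hAB A B \<xi> - c\<bar>)"
    show "jordan (davg ?g A B)" by (rule *(2)) (simp_all add: hAB_def)
    show "negligible (davg ?g A B - closure A)" using *(5) by (simp add: hAB_def clA)
    show "negligible (B - davg ?g A B)"
      by (rule negligible_subset[OF *(4)]) (use clB(2) in \<open>auto simp: hAB_def\<close>)
    show "measure lebesgue (davg ?g A B) = t * measure lebesgue (closure A) + (1 - t) * measure lebesgue B"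
      using *(3) by (simp add: hAB_def mA c)
  qed
qed

lemma partway_Obr:
  fixes A B :: "'a::euclidean_space set"
  assumes A: "jordan A" and B: "Jn B" "B \<subseteq> A" "B \<noteq> {}" and t: "t \<in> {0..1}"
    and c: "c = t * measure lebesgue A + (1 - t) * measure lebesgue B"
  shows "partway t A B (ci (Obr B (SOME r. r \<ge> 0 \<and> measure lebesgue (Obr B r \<inter> A) = c) \<inter> A))"
proof -
  have BJ: "jordan B" and clB: "closed B" and bdB: "bounded B"
    using B Jn_closed by (auto simp: Jn_iff jordan_def)
  have sub: "B \<subseteq> Obr B r" if "r \<ge> 0" for r using that by (auto simp: Obr_def)
  have O0: "Obr B 0 = B"
    using in_closed_iff_infdist_zero[OF clB B(3)] infdist_nonneg[of _ B] by (auto simp: Obr_def order_antisym_conv)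
  have lev: "negligible {p. infdist p B = r}" if "r > 0" for r
    using clB bdB B(3) that by (rule negligible_infdist_level)
  have JO: "jordan (Obr B r)" if "r \<ge> 0" for r
  \<comment> \<open>At radius 0 the neighbourhood is \<open>B\<close> itself, whose frontier is null
    by hypothesis; the porosity argument covers only positive radii.\<close>
  proof (cases "r = 0")
    case True then show ?thesis using O0 BJ by simp
  next
    case False
    have "closed (Obr B r)" unfolding Obr_def by (intro closed_Collect_le continuous_intros)
    moreover have "{p. infdist p B < r} \<subseteq> interior (Obr B r)"
      unfolding Obr_def by (intro interior_maximal open_Collect_less continuous_intros) auto
    ultimately have "frontier (Obr B r) \<subseteq> {p. infdist p B = r}"
      by (force simp: frontier_def Obr_def)
    moreover have "bounded (Obr B r)"
      using compact_infdist_le[of B r] B(3) clB bdB False that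
      by (simp add: Obr_def compact_eq_bounded_closed)
    ultimately show ?thesis using lev[of r] False that negligible_subset by (auto simp: jordan_def)
  qed
  \<comment> \<open>The radius \<open>R\<close> is the upper end for the intermediate value theorem:
    the neighbourhood of that radius already covers \<open>A\<close>.\<close>
  obtain b where b: "b \<in> B" using B by blast
  obtain R where R: "A \<subseteq> cball b R" using bounded_subset_ballD[of A b] A ball_subset_cball
    by (metis jordan_def order_trans)
  have R0: "0 \<le> R" using R b B by fastforce
  have OR: "Obr B R \<inter> A = A"
  proof -
    have "infdist p B \<le> R" if "p \<in> A" for p
      using infdist_le[OF b, of p] that R by (auto simp: dist_commute)
    then show ?thesis by (auto simp: Obr_def)
  qed
  have "continuous_on {0..R} (\<lambda>r. measure lebesgue ({p. 0 \<le> r - infdist p B} \<inter> A))"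
  proof (rule continuous_on_measure_superlevel[OF jordan_lmeasurable[OF A]])
    fix r assume r: "r \<in> {0..R}"
    show "negligible {p \<in> A. r - infdist p B = 0 \<and> (\<exists>y\<in>{0..R}. y - infdist p B < 0)}"
    proof (cases "r = 0")
      case True
      then have "{p \<in> A. r - infdist p B = 0 \<and> (\<exists>y\<in>{0..R}. y - infdist p B < 0)} = {}" by auto
      then show ?thesis by (simp only: negligible_empty)
    next
      case False
      show ?thesis by (rule negligible_subset[OF lev[of r]]) (use False r in auto)
    qed
  qed (intro continuous_intros)+
  then have "continuous_on {0..R} (\<lambda>r. measure lebesgue (Obr B r \<inter> A))"
    by (simp add: Obr_def)
  moreover have "measure lebesgue (Obr B 0 \<inter> A) \<le> c" "c \<le> measure lebesgue (Obr B R \<inter> A)"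
  proof -
    have "measure lebesgue B \<le> measure lebesgue A"
      using A BJ B by (intro measure_mono_fmeasurable) (auto dest: jordan_lmeasurable)
    then have "0 \<le> t * (measure lebesgue A - measure lebesgue B)" "0 \<le> (1 - t) * (measure lebesgue A - measure lebesgue B)"
      using t by auto
    then show "measure lebesgue (Obr B 0 \<inter> A) \<le> c" "c \<le> measure lebesgue (Obr B R \<inter> A)"
      using B(2) unfolding c OR O0 by (auto simp: algebra_simps Int_absorb2)
  qed
  ultimately have "\<exists>r. r \<ge> 0 \<and> measure lebesgue (Obr B r \<inter> A) = c"
    using IVT'[of "\<lambda>r. measure lebesgue (Obr B r \<inter> A)" 0 c R] R0 by auto
  from someI_ex[OF this] obtain r where r: "r \<ge> 0" "measure lebesgue (Obr B r \<inter> A) = c"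
    and eq: "(SOME r. r \<ge> 0 \<and> measure lebesgue (Obr B r \<inter> A) = c) = r" by blast
  have "B - Obr B r \<inter> A = {}" "Obr B r \<inter> A - A = {}" using sub[OF r(1)] B by auto
  then show ?thesis
    unfolding eq using r jordan_Int[OF JO[OF r(1)] A] c by (intro partway_ci) auto
qed

text \<open>The outer set is only required to be \<open>jordan\<close>, because Step 2 applies this
  to \<open>B \<union> C\<close>.\<close>

lemma partway_avg1:
  fixes A B :: "'a::euclidean_space set"
  assumes A: "jordan A" and B: "Jn B" "B \<subseteq> A" and t: "t \<in> {0..1}" and N: "1 \<le> N"
  shows "partway t A B (avg1 N t A B)"
proof (cases "A = B")
  case True
  then show ?thesis using B by (simp add: partway_def avg1_def algebra_simps)
next
  case False
  then have "A \<noteq> {}" using B by auto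
  show ?thesis
  proof (cases "zero_measure_cond A B")
    case True
    then show ?thesis using partway_davg[OF A \<open>A \<noteq> {}\<close> B t N True refl] False
      by (simp add: avg1_def Let_def)
  next
    case nz: False
    then have "B \<noteq> {}" using zero_measure_cond_empty[OF A \<open>A \<noteq> {}\<close>] by auto
    then show ?thesis using partway_Obr[OF A B _ t refl] False nz t
      by (simp add: avg1_def Let_def)
  qed
qed

text \<open>Single components, and the merged small components, need not be regular closed together with
  \<open>B\<close>, but their boundaries are still null: away from the boundaries of \<open>A\<close> and \<open>B\<close>,
  every point of \<open>A - B\<close> has a ball inside one component.\<close>

lemma jordan_Un_components:
  fixes A B :: "'a::euclidean_space set"
  assumes A: "Jn A" and B: "Jn B" "B \<subseteq> A" and C: "\<C> \<subseteq> components (A - B)"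
  shows "jordan (B \<union> \<Union>\<C>)"
proof -
  have WA: "B \<union> \<Union>\<C> \<subseteq> A" using B C in_components_subset by blast
  have clA: "closed A" and clB: "closed B" using A B Jn_closed by auto
  have "frontier (B \<union> \<Union>\<C>) \<subseteq> frontier A \<union> frontier B"
  proof (rule subsetI, rule ccontr)
    fix p assume p: "p \<in> frontier (B \<union> \<Union>\<C>)" and np: "p \<notin> frontier A \<union> frontier B"
    have "p \<in> closure A" using p closure_mono[OF WA] by (auto simp: frontier_def)
    then have pA: "p \<in> interior A" using np by (simp add: frontier_def)
    have nint: "p \<notin> interior (B \<union> \<Union>\<C>)" and clos: "p \<in> closure (B \<union> \<Union>\<C>)" using p by (auto simp: frontier_def)
    have "p \<notin> interior B" using nint interior_mono[of B "B \<union> \<Union>\<C>"] by blast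
    then have pB: "p \<notin> B" using np clB by (auto simp: frontier_def)
    have "open (interior A - B)" using clB by (simp add: open_Diff)
    then obtain e where e: "e > 0" "ball p e \<subseteq> interior A - B"
      using pA pB openE[of "interior A - B" p] by blast
    then have sub: "ball p e \<subseteq> A - B" using interior_subset by blast
    define C where "C = connected_component_set (A - B) p"
    have pAB: "p \<in> A - B" using sub e(1) centre_in_ball by blast
    then have Cc: "C \<in> components (A - B)" by (simp add: C_def componentsI)
    have bC: "ball p e \<subseteq> C"
      unfolding C_def by (intro connected_component_maximal sub connected_ball) (use e in auto)
    show False
    \<comment> \<open>The ball lies in the single component \<open>C\<close>, so it is contained in
      the set or disjoint from it; either way \<open>p\<close> is not on the frontier.\<close>
    proof (cases "C \<in> \<C>")
      case True
      then have "ball p e \<subseteq> B \<union> \<Union>\<C>" using bC by blast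
      then show False using nint e(1) by (meson interiorI open_ball centre_in_ball)
    next
      case False
      have "ball p e \<inter> C' = {}" if "C' \<in> \<C>" for C'
      proof -
        have "C' \<noteq> C" "C' \<in> components (A - B)" using that False C by auto
        then have "C \<inter> C' = {}" using components_nonoverlap[OF Cc] by blast
        then show ?thesis using bC by blast
      qed
      then have "ball p e \<inter> (B \<union> \<Union>\<C>) = {}" using sub by blast
      then have "ball p e \<inter> closure (B \<union> \<Union>\<C>) = {}"
        using open_Int_closure_eq_empty[OF open_ball] by blast
      then show False using clos e(1) centre_in_ball[of p e] by blast
    qed
  qed
  moreover have "negligible (frontier A \<union> frontier B)"
    using A B by (auto simp: Jn_iff jordan_def)
  ultimately have "negligible (frontier (B \<union> \<Union>\<C>))" using negligible_subset by blast
  then show ?thesis using WA A bounded_subset by (auto simp: jordan_def Jn_iff)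
qed

section \<open>Step 2 averages and the pieces of the difference\<close>

lemma comps_cases:
  assumes "C \<in> comps eps A B"
  obtains \<C> where "\<C> \<subseteq> components (A - B)" "C = \<Union>\<C>"
proof -
  \<comment> \<open>Single components and the merged piece both become unions of families of
    components, the form that \<open>jordan_Un_components\<close> accepts.\<close>
  have "\<exists>\<C>. \<C> \<subseteq> components (A - B) \<and> C = \<Union>\<C>"
  proof (cases "C \<in> components (A - B)")
    case True
    then show ?thesis by (intro exI[of _ "{C}"]) auto
  next
    case False
    then have "C = \<Union>{C \<in> components (A - B). measure lebesgue C < eps}"
      using assms by (auto simp: comps_def Let_def split: if_splits)
    then show ?thesis
      by (intro exI[of _ "{C \<in> components (A - B). measure lebesgue C < eps}"]) auto
  qed
  then show ?thesis using that by blast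
qed

lemma Union_comps: "\<Union>(comps eps A B) = A - B"
proof -
  have "\<Union>(comps eps A B) = \<Union>(components (A - B))"
  proof (cases "finite (components (A - B))")
    case False
    have "\<Union>({C \<in> K. eps \<le> f C} \<union> {\<Union>{C \<in> K. f C < eps}}) = \<Union>K" for K :: "'a set set" and f
      by (auto simp: not_le[symmetric])
    then show ?thesis using False by (simp add: comps_def Let_def)
  qed (simp add: comps_def Let_def)
  then show ?thesis by (metis Union_components)
qed

lemma pairwise_disjnt_comps: "pairwise disjnt (comps eps A B)"
proof -
  let ?K = "components (A - B)"
  have dis: "disjnt C D" if "C \<in> ?K" "D \<in> ?K" "C \<noteq> D" for C D
    using that components_nonoverlap unfolding disjnt_def by blast
  have disU: "disjnt C (\<Union>{D \<in> ?K. measure lebesgue D < eps})" if "C \<in> ?K" "eps \<le> measure lebesgue C" for C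
    unfolding disjnt_Union2 using dis[OF that(1)] that(2) by (auto simp: not_le[symmetric])
  show ?thesis
  proof (cases "finite ?K")
    case True
    then show ?thesis using dis by (auto simp: comps_def Let_def pairwise_def)
  next
    case False
    then have eq: "comps eps A B = {C \<in> ?K. measure lebesgue C \<ge> eps} \<union> {\<Union>{C \<in> ?K. measure lebesgue C < eps}}"
      by (simp add: comps_def Let_def)
    show ?thesis unfolding eq
      using dis disU by (auto simp: pairwise_insert disjnt_sym pairwise_def)
  qed
qed

lemma component_lmeasurable:
  assumes "Jn A" "Jn B" "B \<subseteq> A" "\<C> \<subseteq> components (A - B)"
  shows "\<Union>\<C> \<in> lmeasurable"
proof -
  have "\<Union>\<C> \<subseteq> A - B" using assms(4) in_components_subset by blast
  then have "\<Union>\<C> = (B \<union> \<Union>\<C>) - B" by blast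
  also have "\<dots> \<in> lmeasurable"
    using jordan_Un_components[OF assms] assms(2)
    by (intro fmeasurable.Diff jordan_lmeasurable) (auto simp: Jn_iff)
  finally show ?thesis .
qed

text \<open>At most \<open>measure lebesgue A / eps\<close> disjoint components of measure at least
  \<open>eps\<close> fit into \<open>A\<close>, and merging adds one piece.\<close>

lemma finite_comps:
  assumes AB: "Jn A" "Jn B" "B \<subseteq> A" and eps: "eps > 0"
  shows "finite (comps eps A B)"
proof -
  let ?K = "components (A - B)"
  have "finite {C \<in> ?K. eps \<le> measure lebesgue C}"
  proof (rule finite_if_finite_subsets_card_bdd[THEN conjunct1])
    fix F assume F: "F \<subseteq> {C \<in> ?K. eps \<le> measure lebesgue C}" "finite F"
    have m: "C \<in> lmeasurable" if "C \<in> F" for C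
      using component_lmeasurable[OF AB, of "{C}"] that F by auto
    have "real (card F) * eps = (\<Sum>C\<in>F. eps)" by simp
    also have "\<dots> \<le> (\<Sum>C\<in>F. measure lebesgue C)" using F by (intro sum_mono) auto
    also have "\<dots> = measure lebesgue (\<Union>F)"
      using F m components_nonoverlap by (intro measure_Union'[symmetric]) (auto simp: pairwise_def disjnt_def, blast+)
    also have "\<dots> \<le> measure lebesgue A"
    proof (rule measure_mono_fmeasurable)
      show "\<Union>F \<subseteq> A" using F in_components_subset by blast
      show "\<Union>F \<in> sets lebesgue" using F m by (intro sets.finite_Union) auto
      show "A \<in> lmeasurable" using AB by (simp add: Jn_iff jordan_lmeasurable)
    qed
    finally have "real (card F) \<le> measure lebesgue A / eps" using eps by (simp add: field_simps)
    then show "card F \<le> nat \<lfloor>measure lebesgue A / eps\<rfloor>" by (simp add: le_nat_floor)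
  qed
  then show ?thesis by (simp add: comps_def Let_def)
qed

text \<open>Outside \<open>B\<close>, the average for the piece \<open>C\<close> lies almost
  everywhere in \<open>C\<close> and has measure \<open>t\<close> times that of \<open>C\<close>.
  The pieces partition \<open>A - B\<close>, so these contributions add up to \<open>t\<close> times
  its measure.\<close>

lemma partway_avg2:
  fixes A B :: "'a::euclidean_space set"
  assumes A: "Jn A" and B: "Jn B" "B \<subseteq> A" and t: "t \<in> {0..1}" and N: "1 \<le> N" and eps: "eps > 0"
  shows "partway t A B (avg2 N eps t A B)"
proof (cases "A = B")
  case True
  then show ?thesis using B by (simp add: partway_def avg2_def algebra_simps)
next
  case False
  define K where "K = comps eps A B"
  define R where "R = (\<lambda>C. avg1 N t (B \<union> C) B)"
  define M where "M = (\<Union>C\<in>K. R C)"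
  have M: "avg2 N eps t A B = M" using False t by (simp add: avg2_def M_def K_def R_def)
  have fin: "finite K" unfolding K_def by (rule finite_comps[OF A B eps])
  have UK: "\<Union>K = A - B" unfolding K_def by (rule Union_comps)
  have mA: "A \<in> lmeasurable" and mB: "B \<in> lmeasurable"
    using A B by (auto simp: Jn_iff jordan_lmeasurable)
  have KC: "jordan (B \<union> C)" "C \<in> lmeasurable" if CK: "C \<in> K" for C
  proof -
    obtain \<C> where C: "\<C> \<subseteq> components (A - B)" "C = \<Union>\<C>" by (rule comps_cases[OF CK[unfolded K_def]])
    show "jordan (B \<union> C)" "C \<in> lmeasurable"
      using jordan_Un_components[OF A B C(1)] component_lmeasurable[OF A B C(1)] C(2) by auto
  qed
  have R: "partway t (B \<union> C) B (R C)" if "C \<in> K" for C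
    unfolding R_def by (rule partway_avg1[OF KC(1)[OF that] B(1) _ t N]) auto
  have mR: "R C \<in> lmeasurable" if "C \<in> K" for C
    using R[OF that] by (auto simp: partway_def Jn_iff jordan_lmeasurable)
  have Jn: "Jn M" unfolding M_def using fin R by (intro Jn_UN) (auto simp: partway_def)
  have mM: "M \<in> lmeasurable" using Jn by (simp add: Jn_iff jordan_lmeasurable)
  have "K \<noteq> {}" using UK False B by auto
  then obtain C0 where C0: "C0 \<in> K" by blast
  \<comment> \<open>Each \<open>R C\<close> contains \<open>B\<close> almost everywhere, so one
    piece is enough; there is one because \<open>A \<noteq> B\<close>.\<close>
  have BM: "negligible (B - M)"
    by (rule negligible_subset[of "B - R C0"]) (use R[OF C0] C0 in \<open>auto simp: partway_def M_def\<close>)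
  have "negligible (\<Union>C\<in>K. R C - (B \<union> C))"
    using fin R by (intro negligible_Union) (auto simp: partway_def)
  moreover have "M - A \<subseteq> (\<Union>C\<in>K. R C - (B \<union> C))"
    using UK B by (auto simp: M_def)
  ultimately have MA: "negligible (M - A)" by (rule negligible_subset)
  have mC: "measure lebesgue (R C - B) = t * measure lebesgue C" if "C \<in> K" for C
  proof -
    have "measure lebesgue (R C - B) = measure lebesgue (R C) - measure lebesgue B"
      using R[OF that] by (intro measure_ae_Diff mR that mB) (auto simp: partway_def)
    moreover have "measure lebesgue (B \<union> C) = measure lebesgue B + measure lebesgue C"
    proof -
      have "B \<inter> C = {}" using UK that by blast
      then show ?thesis using measure_Un3[OF mB KC(2)[OF that]] by simp
    qed
    ultimately show ?thesis using R[OF that] by (simp add: partway_def algebra_simps)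
  qed
  have "measure lebesgue M - measure lebesgue B = measure lebesgue (M - B)"
    using measure_ae_Diff[OF mM mB BM] by simp
  also have "M - B = (\<Union>C\<in>K. R C - B)" by (auto simp: M_def)
  also have "measure lebesgue \<dots> = (\<Sum>C\<in>K. measure lebesgue (R C - B))"
  proof (rule measure_negligible_finite_Union_image[OF fin])
    show "R C - B \<in> lmeasurable" if "C \<in> K" for C using mR[OF that] mB by (rule fmeasurable.Diff)
    show "pairwise (\<lambda>C D. negligible ((R C - B) \<inter> (R D - B))) K"
      unfolding pairwise_def
    proof (intro ballI impI)
      fix C D assume CD: "C \<in> K" "D \<in> K" "C \<noteq> D"
      then have "C \<inter> D = {}" using pairwise_disjnt_comps[of eps A B] by (auto simp: K_def pairwise_def disjnt_def)
      \<comment> \<open>A common point outside \<open>B\<close> cannot be in both disjoint pieces,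
        so it belongs to one of the null excesses.\<close>
      then have "(R C - B) \<inter> (R D - B) \<subseteq> (R C - (B \<union> C)) \<union> (R D - (B \<union> D))" by blast
      then show "negligible ((R C - B) \<inter> (R D - B))"
        using R[OF CD(1)] R[OF CD(2)] by (rule_tac negligible_subset[OF negligible_Un]) (auto simp: partway_def)
    qed
  qed
  also have "\<dots> = t * (\<Sum>C\<in>K. measure lebesgue C)" by (simp add: mC sum_distrib_left)
  also have "(\<Sum>C\<in>K. measure lebesgue C) = measure lebesgue (\<Union>K)"
    using fin KC pairwise_disjnt_comps unfolding K_def by (intro measure_Union'[symmetric]) auto
  also have "\<dots> = measure lebesgue A - measure lebesgue B"
    unfolding UK by (rule measurable_measure_Diff) (use mA mB B in auto)
  finally have "measure lebesgue M = t * measure lebesgue A + (1 - t) * measure lebesgue B"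
    by (simp add: algebra_simps)
  then show ?thesis unfolding M partway_def using Jn BM MA by blast
qed

section \<open>The metric property of the measure average\<close>

lemma dmu_eq:
  assumes "S \<in> lmeasurable" "T \<in> lmeasurable"
  shows "dmu S T = measure lebesgue S + measure lebesgue T - 2 * measure lebesgue (S \<inter> T)"
proof -
  have "dmu S T = measure lebesgue (S - T) + measure lebesgue (T - S)"
  proof -
    have "(S - T) \<inter> (T - S) = {}" by blast
    then show ?thesis
      using measure_Un3[OF fmeasurable.Diff[OF assms] fmeasurable.Diff[OF assms(2,1)]] by (simp add: dmu_def)
  qed
  moreover have "measure lebesgue (S - T) = measure lebesgue S - measure lebesgue (S \<inter> T)"
    "measure lebesgue (T - S) = measure lebesgue T - measure lebesgue (S \<inter> T)"
    using measurable_measure_Diff[of S lebesgue "S \<inter> T"] measurable_measure_Diff[of T lebesgue "S \<inter> T"]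
      fmeasurable_Int_fmeasurable[OF assms(1) fmeasurableD[OF assms(2)]] assms
    by (simp_all add: Diff_Int fmeasurableD)
  ultimately show ?thesis by simp
qed

lemma dmu_commute: "dmu S T = dmu T S"
  by (simp add: dmu_def Un_commute)

lemma dmu_nonneg: "0 \<le> dmu S T"
  by (simp add: dmu_def)

lemma dmu_triangle:
  assumes "S \<in> lmeasurable" "T \<in> lmeasurable" "U \<in> lmeasurable"
  shows "dmu S U \<le> dmu S T + dmu T U"
proof -
  have D: "(S - T) \<union> (T - S) \<in> lmeasurable" "(T - U) \<union> (U - T) \<in> lmeasurable"
    by (intro fmeasurable.Un fmeasurable.Diff assms)+
  have "dmu S U \<le> measure lebesgue (((S - T) \<union> (T - S)) \<union> ((T - U) \<union> (U - T)))"
    unfolding dmu_def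
  proof (rule measure_mono_fmeasurable)
    show "(S - U) \<union> (U - S) \<in> sets lebesgue"
      by (intro fmeasurableD fmeasurable.Un fmeasurable.Diff assms)
    show "((S - T) \<union> (T - S)) \<union> ((T - U) \<union> (U - T)) \<in> lmeasurable"
      by (intro fmeasurable.Un D)
  qed auto
  also have "\<dots> \<le> dmu S T + dmu T U"
    unfolding dmu_def by (intro measure_Un_le fmeasurableD D)
  finally show ?thesis .
qed

text \<open>Up to null sets, \<open>R1\<close> lies between \<open>I\<close> and \<open>A\<close>,
  and \<open>R2\<close> between \<open>I\<close> and \<open>B\<close>, where \<open>I\<close> is
  almost \<open>A \<inter> B\<close>. Hence \<open>R1 \<inter> R2\<close> is almost
  \<open>I\<close>, and the average cuts \<open>A\<close> and \<open>B\<close> in almost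
  \<open>R1\<close> and \<open>R2\<close>. The distances are then linear arithmetic in the
  measures.\<close>

lemma mavg_metric:
  fixes A B :: "'a::euclidean_space set"
  assumes A: "Jn A" and B: "Jn B" and t: "t \<in> {0..1}" and N: "1 \<le> N" and eps: "eps > 0"
  shows "Jn (mavg N eps t A B)" (is "Jn ?M")
    and "dmu (mavg N eps t A B) A = (1 - t) * dmu A B"
    and "dmu (mavg N eps t A B) B = t * dmu A B"
proof -
  have "Jn ?M \<and> dmu ?M A = (1 - t) * dmu A B \<and> dmu ?M B = t * dmu A B"
  proof (cases "A = B")
    case True
    then show ?thesis using A by (simp add: mavg_def dmu_def)
  next
    case False
    define I where "I = ci (A \<inter> B)"
    define R1 where "R1 = avg2 N eps t A I"
    define R2 where "R2 = avg2 N eps (1 - t) B I"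
    have M: "?M = R1 \<union> R2" using False t by (simp add: mavg_def R1_def R2_def I_def Let_def)
    have JI: "jordan (A \<inter> B)" using A B by (simp add: Jn_iff jordan_Int)
    have I: "Jn I" "I \<subseteq> A \<inter> B"
      unfolding I_def using Jn_ci[OF JI] ci_subset[of "A \<inter> B"] A B by (auto simp: Jn_closed closed_Int)
    have nI: "negligible (A \<inter> B - I)"
      unfolding I_def using JI by (intro negligible_ci_symdiff) (simp add: jordan_def)
    have R1: "partway t A I R1" unfolding R1_def using I by (intro partway_avg2 A t N eps) auto
    have R2: "partway (1 - t) B I R2" unfolding R2_def using I t by (intro partway_avg2 B N eps) auto
    have J: "Jn (R1 \<union> R2)" using R1 R2 by (intro Jn_Un) (auto simp: partway_def)
    have m: "A \<in> lmeasurable" "B \<in> lmeasurable" "I \<in> lmeasurable" "R1 \<in> lmeasurable" "R2 \<in> lmeasurable"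
      using A B I R1 R2 by (auto simp: partway_def Jn_iff jordan_lmeasurable)
    have n: "negligible (I - R1)" "negligible (R1 - A)" "negligible (I - R2)" "negligible (R2 - B)"
      using R1 R2 by (auto simp: partway_def)
    \<comment> \<open>Off this one null set all inclusions hold exactly, so each identity below is a
      set-theoretic fact there.\<close>
    have n1: "negligible ((R1 - A) \<union> (R2 - B) \<union> (A \<inter> B - I) \<union> (I - R1) \<union> (I - R2))"
      using n nI by (intro negligible_Un) auto
    note ns = negligible_subset[OF n1]
    have AB: "measure lebesgue (A \<inter> B) = measure lebesgue I"
      by (rule measure_ae_eq[OF m(3)]) (use I in \<open>auto intro!: ns\<close>)
    have RR: "measure lebesgue (R1 \<inter> R2) = measure lebesgue I"
      by (rule measure_ae_eq[OF m(3)]) (auto intro!: ns)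
    have MA: "measure lebesgue ((R1 \<union> R2) \<inter> A) = measure lebesgue R1"
      by (rule measure_ae_eq[OF m(4)]) (auto intro!: ns)
    have MB: "measure lebesgue ((R1 \<union> R2) \<inter> B) = measure lebesgue R2"
      by (rule measure_ae_eq[OF m(5)]) (auto intro!: ns)
    have mM: "measure lebesgue (R1 \<union> R2) = measure lebesgue R1 + measure lebesgue R2 - measure lebesgue I"
      using measure_Un3[OF m(4,5)] RR by simp
    have e1: "measure lebesgue R1 = t * measure lebesgue A + (1 - t) * measure lebesgue I"
      and e2: "measure lebesgue R2 = (1 - t) * measure lebesgue B + t * measure lebesgue I"
      using R1 R2 by (auto simp: partway_def)
    have mU: "R1 \<union> R2 \<in> lmeasurable" using m by auto
    have "dmu (R1 \<union> R2) A = (1 - t) * dmu A B" "dmu (R1 \<union> R2) B = t * dmu A B"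
      unfolding dmu_eq[OF mU m(1)] dmu_eq[OF mU m(2)] dmu_eq[OF m(1,2)] AB MA MB mM e1 e2
      by (simp_all add: algebra_simps)
    then show ?thesis using J M by simp
  qed
  then show "Jn ?M" "dmu ?M A = (1 - t) * dmu A B" "dmu ?M B = t * dmu A B" by auto
qed

section \<open>Convergence of the spline scheme\<close>

lemma Jn_lmeasurable: "Jn S \<Longrightarrow> S \<in> lmeasurable"
  by (simp add: Jn_iff jordan_lmeasurable)

lemmas Jn_dmu_triangle = dmu_triangle[OF Jn_lmeasurable Jn_lmeasurable Jn_lmeasurable]

text \<open>Bounds the cost of the index shift in \<open>refine\<close>.\<close>

lemma dmu_chain:
  assumes J: "\<And>i::int. Jn (H i)" and D: "\<And>i. dmu (H i) (H (i + 1)) \<le> D"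
  shows "dmu (H (i - int s)) (H i) \<le> real s * D"
proof (induction s)
  case 0
  then show ?case by (simp add: dmu_def)
next
  case (Suc s)
  have "dmu (H (i - int (Suc s))) (H i) \<le> dmu (H (i - int (Suc s))) (H (i - int s)) + dmu (H (i - int s)) (H i)"
    by (intro Jn_dmu_triangle J)
  also have "\<dots> \<le> D + real s * D" using D[of "i - int (Suc s)"] Suc by (intro add_mono) simp_all
  finally show ?case by (simp add: algebra_simps)
qed

text \<open>Neighbouring midpoints share the parent \<open>H (i + 1)\<close> and each is within
  \<open>D / 2\<close> of it, so gaps do not grow. Each round moves a set by at most
  \<open>D / 2\<close>, bounded here by \<open>D\<close>.\<close>

lemma averages_metric:
  fixes H :: "int \<Rightarrow> 'a::euclidean_space set"
  assumes J: "\<And>i. Jn (H i)" and D: "\<And>i. dmu (H i) (H (i + 1)) \<le> D" and N: "1 \<le> N" "eps > 0"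
  defines "S \<equiv> \<lambda>H i. mavg N eps (1/2) (H i) (H (i + 1))"
  shows "Jn ((S ^^ n) H i) \<and> dmu ((S ^^ n) H i) ((S ^^ n) H (i + 1)) \<le> D \<and>
    dmu ((S ^^ n) H i) (H i) \<le> real n * D"
proof (induction n arbitrary: i)
  case 0
  then show ?case using J D by (simp add: dmu_def)
next
  case (Suc n)
  define H' where "H' = (S ^^ n) H"
  have eq: "(S ^^ Suc n) H i = mavg N eps (1/2) (H' i) (H' (i + 1))" for i
    by (simp add: S_def H'_def)
  have J': "Jn (H' i)" and D': "dmu (H' i) (H' (i + 1)) \<le> D" and H: "dmu (H' i) (H i) \<le> real n * D" for i
    using Suc unfolding H'_def by auto
  note m = mavg_metric[OF J' J' _ N, of "1/2"]
  have JS: "Jn ((S ^^ Suc n) H i)" for i unfolding eq by (rule m) auto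
  have left: "dmu ((S ^^ Suc n) H i) (H' i) \<le> D / 2" for i
    unfolding eq using m(2)[of i "i + 1"] D'[of i] by simp
  have right: "dmu ((S ^^ Suc n) H i) (H' (i + 1)) \<le> D / 2" for i
    unfolding eq using m(3)[of i "i + 1"] D'[of i] by simp
  have "dmu ((S ^^ Suc n) H i) ((S ^^ Suc n) H (i + 1)) \<le> D"
    using Jn_dmu_triangle[OF JS[of i] J'[of "i + 1"] JS[of "i + 1"]] right[of i] left[of "i + 1"]
    by (simp add: dmu_commute)
  moreover have "D \<ge> 0" using D dmu_nonneg order_trans by blast
  then have "dmu ((S ^^ Suc n) H i) (H i) \<le> real (Suc n) * D"
    using Jn_dmu_triangle[OF JS[of i] J'[of i] J[of i]] left[of i] H[of i] by (simp add: algebra_simps)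
  ultimately show ?case using JS by blast
qed

text \<open>The inserted sequence has gaps \<open>D / 2\<close> and carries \<open>F i\<close> at
  index \<open>2 * i\<close>. The \<open>m - 1\<close> averagings and the shift by
  \<open>(m - 1) div 2\<close> cost at most \<open>D / 2\<close> per unit, hence at most
  \<open>real m * D\<close> together.\<close>

lemma refine_metric:
  fixes F :: "int \<Rightarrow> 'a::euclidean_space set"
  assumes J: "\<And>i. Jn (F i)" and D: "\<And>i. dmu (F i) (F (i + 1)) \<le> D" and N: "1 \<le> N" "eps > 0"
  shows "Jn (refine N eps m F i)"
    and "dmu (refine N eps m F i) (refine N eps m F (i + 1)) \<le> D / 2"
    and "dmu (refine N eps m F (2 * i)) (F i) \<le> real m * D"
proof -
  define F0 where "F0 = (\<lambda>i. if even i then F (i div 2) else mavg N eps (1/2) (F (i div 2)) (F (i div 2 + 1)))"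
  define S where "S = (\<lambda>(H :: int \<Rightarrow> 'a set) i. mavg N eps (1/2) (H i) (H (i + 1)))"
  define s where "s = (m - 1) div 2"
  have ref: "refine N eps m F i = (S ^^ (m - 1)) F0 (i - int s)" for i
    by (simp add: refine_def F0_def S_def s_def Let_def)
  note mm = mavg_metric[OF J J _ N, of "1/2"]
  have J0: "Jn (F0 i)" for i by (simp add: F0_def J mm)
  have D0: "dmu (F0 i) (F0 (i + 1)) \<le> D / 2" for i
  proof (cases "even i")
    case True
    then obtain j where j: "i = 2 * j" by (rule evenE)
    show ?thesis using mm(2)[of j "j + 1"] D[of j] by (simp add: F0_def j dmu_commute)
  next
    case False
    then obtain j where j: "i = 2 * j + 1" by (rule oddE)
    have "i + 1 = 2 * (j + 1)" by (simp add: j)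
    then have "F0 (i + 1) = F (j + 1)" by (simp only: F0_def) simp
    moreover have "F0 i = mavg N eps (1/2) (F j) (F (j + 1))" by (simp add: F0_def j)
    ultimately show ?thesis using mm(3)[of j "j + 1"] D[of j] by simp
  qed
  have av: "Jn ((S ^^ n) F0 i)" "dmu ((S ^^ n) F0 i) ((S ^^ n) F0 (i + 1)) \<le> D / 2"
    "dmu ((S ^^ n) F0 i) (F0 i) \<le> real n * (D / 2)" for n i
    using averages_metric[where H = F0, OF J0 D0 N] unfolding S_def by blast+
  show "Jn (refine N eps m F i)" unfolding ref by (rule av)
  show "dmu (refine N eps m F i) (refine N eps m F (i + 1)) \<le> D / 2"
    using av(2)[of "m - 1" "i - int s"] unfolding ref by (simp add: algebra_simps)
  have D_nonneg: "0 \<le> D" using D dmu_nonneg order_trans by blast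
  have "dmu (refine N eps m F (2 * i)) (F0 (2 * i))
      \<le> dmu (refine N eps m F (2 * i)) (F0 (2 * i - int s)) + dmu (F0 (2 * i - int s)) (F0 (2 * i))"
    unfolding ref by (intro Jn_dmu_triangle av J0)
  also have "\<dots> \<le> real (m - 1) * (D / 2) + real s * (D / 2)"
    unfolding ref by (intro add_mono av dmu_chain J0 D0)
  also have "\<dots> \<le> real m * (D / 2) + real m * (D / 2)"
    using D_nonneg by (intro add_mono mult_right_mono) (auto simp: s_def)
  finally show "dmu (refine N eps m F (2 * i)) (F i) \<le> real m * D" by (simp add: F0_def mult.commute)
qed

lemma spline_metric:
  fixes F :: "int \<Rightarrow> 'a::euclidean_space set"
  assumes J: "\<And>i. Jn (F i)" and D: "\<And>i. dmu (F i) (F (i + 1)) \<le> D" and N: "1 \<le> N" "eps > 0"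
  shows "Jn (spline N eps m F k i) \<and> dmu (spline N eps m F k i) (spline N eps m F k (i + 1)) \<le> D / 2 ^ k"
proof (induction k arbitrary: i)
  case 0
  then show ?case using J D by (simp add: spline_def)
next
  case (Suc k)
  have eq: "spline N eps m F (Suc k) = refine N eps m (spline N eps m F k)" by (simp add: spline_def)
  show ?case
    using refine_metric(1,2)[where F = "spline N eps m F k", OF conjunct1[OF Suc] conjunct2[OF Suc] N, of m i] unfolding eq
    by (simp add: mult.commute)
qed

text \<open>Follows the left end of the dyadic cell of \<open>y\<close> through the levels. Passing
  from level \<open>j\<close> to the next costs at most \<open>real (m + 1) * (D / 2 ^ j)\<close>,
  and the right-hand side is the partial geometric sum over \<open>j < k\<close>.\<close>

lemma spline_floor_dist:
  fixes F :: "int \<Rightarrow> 'a::euclidean_space set" and y :: real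
  assumes J: "\<And>i. Jn (F i)" and D: "\<And>i. dmu (F i) (F (i + 1)) \<le> D" and N: "1 \<le> N" "eps > 0"
  shows "dmu (spline N eps m F k \<lfloor>y * 2 ^ k\<rfloor>) (F \<lfloor>y\<rfloor>) \<le> 2 * real (m + 1) * D * (1 - 1 / 2 ^ k)"
proof (induction k)
  case 0
  then show ?case by (simp add: spline_def dmu_def)
next
  case (Suc k)
  note sp = spline_metric[where F = F, OF J D N, of m]
  define i where "i = \<lfloor>y * 2 ^ k\<rfloor>"
  define H where "H = spline N eps m F k"
  define H' where "H' = spline N eps m F (Suc k)"
  have eq: "H' = refine N eps m H" by (simp add: H_def H'_def spline_def)
  have JH: "Jn (H i)" "Jn (H' i)" for i using sp by (simp_all add: H_def H'_def)
  have D_nonneg: "0 \<le> D" using D dmu_nonneg order_trans by blast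
  have DH': "dmu (H' i) (H' (i + 1)) \<le> D / 2 ^ k" for i
  proof -
    have "dmu (H' i) (H' (i + 1)) \<le> D / 2 ^ Suc k" using sp by (simp only: H'_def)
    also have "\<dots> \<le> D / 2 ^ k" using D_nonneg by (intro divide_left_mono) auto
    finally show ?thesis .
  qed
  have even: "dmu (H' (2 * i)) (H i) \<le> real m * (D / 2 ^ k)" for i
    unfolding eq using sp by (intro refine_metric(3) N) (simp_all add: H_def)
  have "dmu (H' \<lfloor>y * 2 ^ Suc k\<rfloor>) (H i) \<le> real (m + 1) * (D / 2 ^ k)"
  proof -
    \<comment> \<open>The new cell is the left or right half of the old one; the right half costs
      one further gap of \<open>H'\<close>, which turns \<open>m\<close> into
      \<open>m + 1\<close>.\<close>
    have "of_int i \<le> y * 2 ^ k" "y * 2 ^ k < of_int i + 1" by (simp_all add: i_def)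
    then have "\<lfloor>y * 2 ^ Suc k\<rfloor> = 2 * i \<or> \<lfloor>y * 2 ^ Suc k\<rfloor> = 2 * i + 1"
      by (simp add: floor_eq_iff mult.left_commute[of _ 2]) linarith
    then show ?thesis
    proof
      assume "\<lfloor>y * 2 ^ Suc k\<rfloor> = 2 * i"
      moreover have "0 \<le> D / 2 ^ k" using D_nonneg by simp
      ultimately show ?thesis using even[of i] by (simp add: distrib_right add_divide_distrib)
    next
      assume "\<lfloor>y * 2 ^ Suc k\<rfloor> = 2 * i + 1"
      then show ?thesis
        using Jn_dmu_triangle[OF JH(2)[of "2 * i + 1"] JH(2)[of "2 * i"] JH(1)[of i]] DH'[of "2 * i"] even[of i]
        by (simp add: dmu_commute distrib_right add_divide_distrib)
    qed
  qed
  then have "dmu (H' \<lfloor>y * 2 ^ Suc k\<rfloor>) (F \<lfloor>y\<rfloor>)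
      \<le> real (m + 1) * (D / 2 ^ k) + 2 * real (m + 1) * D * (1 - 1 / 2 ^ k)"
    using Jn_dmu_triangle[OF JH(2) JH(1) J, of "\<lfloor>y * 2 ^ Suc k\<rfloor>" "\<lfloor>y\<rfloor>" i] Suc by (simp add: H_def i_def)
  also have "\<dots> = 2 * real (m + 1) * D * (1 - 1 / 2 ^ Suc k)" by (simp add: field_simps)
  finally show ?case by (simp add: H'_def)
qed

lemma interp_dist:
  fixes F :: "int \<Rightarrow> 'a::euclidean_space set"
  assumes J: "\<And>i. Jn (F i)" and D: "\<And>i. dmu (F i) (F (i + 1)) \<le> D" and N: "1 \<le> N" "eps > 0"
  shows "Jn (interp N eps F k y)" "dmu (interp N eps F k y) (F \<lfloor>y * 2 ^ k\<rfloor>) \<le> D"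
proof -
  define i where "i = \<lfloor>y * 2 ^ k\<rfloor>"
  define \<theta> where "\<theta> = of_int (i + 1) - y * 2 ^ k"
  have \<theta>: "0 \<le> \<theta>" "\<theta> \<le> 1" unfolding \<theta>_def i_def by linarith+
  have eq: "interp N eps F k y = mavg N eps \<theta> (F i) (F (i + 1))"
    by (simp add: interp_def i_def \<theta>_def Let_def)
  note mm = mavg_metric[OF J J _ N, of \<theta> i "i + 1"]
  show "Jn (interp N eps F k y)" unfolding eq using \<theta> by (intro mm) auto
  have "dmu (interp N eps F k y) (F i) = (1 - \<theta>) * dmu (F i) (F (i + 1))"
    unfolding eq using \<theta> by (intro mm) auto
  also have "\<dots> \<le> 1 * dmu (F i) (F (i + 1))" using \<theta> dmu_nonneg by (intro mult_right_mono) auto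
  finally show "dmu (interp N eps F k y) (F \<lfloor>y * 2 ^ k\<rfloor>) \<le> D" using D[of i] by (simp add: i_def)
qed

text \<open>The values of \<open>G\<close> are only representatives modulo null sets, so
  \<open>F0\<close> is a separate family that meets the samples at distance 0. The constant is
  chosen before \<open>G\<close>, \<open>h\<close>, \<open>N\<close> and \<open>eps\<close>.\<close>

theorem mainTheorem11:
  fixes m :: nat and L :: real
  assumes "m \<ge> 1"
  shows "\<exists>C::real. \<forall>(G :: real \<Rightarrow> 'a::euclidean_space set) (h::real) (\<delta>::real) (N::real) (eps::real)
            (F0 :: int \<Rightarrow> 'a set) (x::real) (k::nat).
    (\<forall>y. Ln (G y)) \<and> (\<forall>y z. dmu (G y) (G z) \<le> L * \<bar>y - z\<bar>) \<and>
    h > 0 \<and> 0 \<le> \<delta> \<and> \<delta> < h \<and> N \<ge> 1 \<and> eps > 0 \<and>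
    (\<forall>i. Jn (F0 i) \<and> dmu (F0 i) (G (\<delta> + of_int i * h)) = 0)
    \<longrightarrow> dmu (G x) (interp N eps (spline N eps m F0 k) k ((x - \<delta>) / h)) \<le> C * h"
proof (intro exI[of _ "(2 * real (m + 1) + 2) * L"] allI impI, elim conjE)
  fix G :: "real \<Rightarrow> 'a set" and h \<delta> N eps :: real and F0 :: "int \<Rightarrow> 'a set" and x :: real and k :: nat
  assume G: "\<forall>y. Ln (G y)" and L: "\<forall>y z. dmu (G y) (G z) \<le> L * \<bar>y - z\<bar>"
    and h: "h > 0" and "0 \<le> \<delta>" "\<delta> < h" and N: "N \<ge> 1" "eps > 0"
    and F: "\<forall>i. Jn (F0 i) \<and> dmu (F0 i) (G (\<delta> + of_int i * h)) = 0"
  have mG: "G y \<in> lmeasurable" for y using G unfolding Ln_def by (blast intro: fmeasurableI)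
  have J: "Jn (F0 i)" and FG: "dmu (F0 i) (G (\<delta> + of_int i * h)) = 0" for i using F by auto
  have D: "dmu (F0 i) (F0 (i + 1)) \<le> L * h" for i
  proof -
    let ?g = "\<lambda>i. G (\<delta> + of_int i * h)"
    have "dmu (F0 i) (F0 (i + 1)) \<le> dmu (F0 i) (?g i) + dmu (?g i) (F0 (i + 1))"
      by (intro dmu_triangle Jn_lmeasurable J mG)
    also have "dmu (?g i) (F0 (i + 1)) \<le> dmu (?g i) (?g (i + 1)) + dmu (?g (i + 1)) (F0 (i + 1))"
      by (intro dmu_triangle Jn_lmeasurable J mG)
    also have "dmu (?g i) (?g (i + 1)) \<le> L * \<bar>(\<delta> + of_int i * h) - (\<delta> + of_int (i + 1) * h)\<bar>"
      using L by blast
    also have "\<dots> = L * h" using h by (simp add: algebra_simps)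
    finally show ?thesis using FG[of i] FG[of "i + 1"] by (simp add: dmu_commute)
  qed
  \<comment> \<open>The sign comes from the fact that \<open>L * h\<close> bounds a
    distance.\<close>
  have Lh: "0 \<le> L * h" using D[of 0] dmu_nonneg[of "F0 0" "F0 (0 + 1)"] by linarith
  define y where "y = (x - \<delta>) / h"
  define H where "H = spline N eps m F0 k"
  define i where "i = \<lfloor>y * 2 ^ k\<rfloor>"
  have JH: "Jn (H i)" and DH: "dmu (H i) (H (i + 1)) \<le> L * h" for i
  proof -
    have "dmu (H i) (H (i + 1)) \<le> L * h / 2 ^ k" "Jn (H i)"
      using spline_metric[where F = F0, OF J D N, of m k i] by (auto simp: H_def)
    moreover have "L * h / 2 ^ k \<le> L * h / 1" using Lh by (intro divide_left_mono) auto
    ultimately show "Jn (H i)" "dmu (H i) (H (i + 1)) \<le> L * h" by auto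
  qed
  note id = interp_dist[where F = H, OF JH DH N, of k y]
  have b1: "dmu (G x) (F0 \<lfloor>y\<rfloor>) \<le> L * h"
  proof -
    let ?z = "\<delta> + of_int \<lfloor>y\<rfloor> * h"
    have xy: "x - ?z = (y - of_int \<lfloor>y\<rfloor>) * h" using h by (simp add: y_def field_simps)
    have fl: "0 \<le> y - of_int \<lfloor>y\<rfloor>" "y - of_int \<lfloor>y\<rfloor> \<le> 1" by linarith+
    then have "\<bar>x - ?z\<bar> = (y - of_int \<lfloor>y\<rfloor>) * h" unfolding xy using h by simp
    then have "L * \<bar>x - ?z\<bar> = (y - of_int \<lfloor>y\<rfloor>) * (L * h)" by simp
    also have "\<dots> \<le> 1 * (L * h)" by (intro mult_right_mono fl Lh)
    finally have "dmu (G x) (G ?z) \<le> L * h" using L by (metis mult_1 order_trans)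
    then show ?thesis
      using dmu_triangle[OF mG mG Jn_lmeasurable[OF J], of x "\<lfloor>y\<rfloor>" ?z] FG[of "\<lfloor>y\<rfloor>"] by (simp add: dmu_commute)
  qed
  have b2: "dmu (H i) (F0 \<lfloor>y\<rfloor>) \<le> 2 * real (m + 1) * (L * h)"
  proof -
    have "dmu (H i) (F0 \<lfloor>y\<rfloor>) \<le> 2 * real (m + 1) * (L * h) * (1 - 1 / 2 ^ k)"
      unfolding H_def i_def by (rule spline_floor_dist[where F = F0, OF J D N])
    also have "\<dots> \<le> 2 * real (m + 1) * (L * h) * 1" using Lh by (intro mult_left_mono) auto
    finally show ?thesis by simp
  qed
  \<comment> \<open>Three contributions: \<open>L * h\<close> from \<open>x\<close> to its grid
    point, \<open>2 * real (m + 1) * (L * h)\<close> for the drift of the spline sets, and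
    \<open>L * h\<close> for the final interpolation.\<close>
  have "dmu (G x) (interp N eps H k y) \<le> dmu (G x) (F0 \<lfloor>y\<rfloor>) + dmu (F0 \<lfloor>y\<rfloor>) (interp N eps H k y)"
    by (intro dmu_triangle Jn_lmeasurable J mG id(1))
  also have "dmu (F0 \<lfloor>y\<rfloor>) (interp N eps H k y) \<le> dmu (F0 \<lfloor>y\<rfloor>) (H i) + dmu (H i) (interp N eps H k y)"
    by (intro Jn_dmu_triangle J JH id(1))
  also have "dmu (H i) (interp N eps H k y) \<le> L * h" using id(2) by (simp add: dmu_commute i_def)
  finally have "dmu (G x) (interp N eps H k y) \<le> (2 * real (m + 1) + 2) * (L * h)"
    using b1 b2 by (simp add: dmu_commute algebra_simps)
  then show "dmu (G x) (interp N eps (spline N eps m F0 k) k ((x - \<delta>) / h)) \<le> (2 * real (m + 1) + 2) * L * h"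
    by (simp add: H_def y_def mult.assoc)
qed

end
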